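(* Let $\mathbb{P}$ be a finite classical polar space of rank $d\ge 3$ over $\mathbb{F}_q$, given by a polarity $\perp$ of $\mathbb{F}_q^n$ (i.e. $\mathbb{P}$ is symplectic, Hermitian, or a quadric with $q$ odd). Let $\Gamma$ be its collinearity graph. Let $P$ be a totally isotropic subspace of dimension $m$ with $2\le m\le d$, and let $L_1\ne L_2$ be hyperplanes (i.e. $(m-1)$-dimensional subspaces) of $P$. Let $C_1$ be the set of points ($1$-dimensional subspaces) of $L_1$ not contained in $L_2$, and $C_2$ the set of points of $L_2$ not contained in $L_1$. Then $\{C_1,C_2\}$ is a switching set of $\Gamma$. Moreover, if $d=m\ge 3$, then the graph $\overline{\Gamma}$ obtained from $\Gamma$ by switching with respect to $\{C_1,C_2\}$ is not isomorphic to $\Gamma$.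
   Context: A subspace $S$ is isotropic (totally isotropic) if $S\subseteq S^\perp$; the rank $d$ of $\mathbb{P}$ is the dimension of its maximal totally isotropic subspaces. The collinearity graph $\Gamma$ has the isotropic points ($1$-dimensional subspaces $x$ with $x\subseteq x^\perp$) as vertices, two distinct isotropic points $x,y$ being adjacent iff $x\subseteq y^\perp$. For a vertex $x$, $\Gamma(x)$ is its neighbourhood. For disjoint vertex sets $C_1,C_2$ with $D$ the remaining vertices: $\{C_1,C_2\}$ is a switching set if $|C_1|=|C_2|$, the induced subgraphs on $C_1$, $C_2$, $C_1\cup C_2$ are regular with equal degrees on $C_1$ and $C_2$, and every $x\in D$ satisfies $|\Gamma(x)\cap C_1|=|\Gamma(x)\cap C_2|$ or $\Gamma(x)\cap(C_1\cup C_2)\in\{C_1,C_2\}$. The graph $\overline{\Gamma}$ obtained by switching has the same vertices, the same edges inside $C_1\cup C_2$ and inside $D$, and for $x\in D$: $\overline{\Gamma}(x)\cap(C_1\cup C_2)$ equals $C_1$ if $\Gamma(x)\cap(C_1\cup C_2)=C_2$, equals $C_2$ if $\Gamma(x)\cap(C_1\cup C_2)=C_1$, and equals $\Gamma(x)\cap(C_1\cup C_2)$ otherwise. *)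

theory Defs
  imports
    "HOL-Analysis.Cartesian_Space"
    "Graph_Theory.Pair_Digraph"
    "Graph_Theory.Digraph_Component"
    "Graph_Theory.Digraph_Isomorphism"
begin

subsection \<open>Polarities and forms\<close>

text \<open>
  The finite field is a type of class \<open>{field, finite}\<close>, so \<open>q = CARD('a)\<close>, and its \<open>n\<close>-dimensional
  column space is \<open>'a ^ 'n\<close> with \<open>n = CARD('n)\<close>. A polarity acts on subspaces, represented by their
  carrier sets; its values on sets that are not subspaces are irrelevant.
\<close>

definition polarity :: "(('a::field ^ 'n) set \<Rightarrow> ('a ^ 'n) set) \<Rightarrow> bool" where
  "polarity perp \<longleftrightarrow>
     (\<forall>S. vec.subspace S \<longrightarrow> vec.subspace (perp S) \<and> perp (perp S) = S) \<and>
     (\<forall>S T. vec.subspace S \<longrightarrow> vec.subspace T \<longrightarrow> S \<subseteq> T \<longrightarrow> perp T \<subseteq> perp S)"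

definition sesquilinear_form :: "('a \<Rightarrow> 'a) \<Rightarrow> ('a::field ^ 'n \<Rightarrow> 'a ^ 'n \<Rightarrow> 'a) \<Rightarrow> bool" where
  "sesquilinear_form \<sigma> B \<longleftrightarrow>
     (\<forall>u v w. B (u + v) w = B u w + B v w) \<and>
     (\<forall>u v w. B u (v + w) = B u v + B u w) \<and>
     (\<forall>c u v. B (c *s u) v = c * B u v) \<and>
     (\<forall>c u v. B u (c *s v) = \<sigma> c * B u v)"

abbreviation bilinear_form :: "('a::field ^ 'n \<Rightarrow> 'a ^ 'n \<Rightarrow> 'a) \<Rightarrow> bool" where
  "bilinear_form \<equiv> sesquilinear_form (\<lambda>c. c)"

definition nondegenerate :: "('a::field ^ 'n \<Rightarrow> 'a ^ 'n \<Rightarrow> 'a) \<Rightarrow> bool" where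
  "nondegenerate B \<longleftrightarrow>
     (\<forall>u. (\<forall>v. B u v = 0) \<longrightarrow> u = 0) \<and> (\<forall>v. (\<forall>u. B u v = 0) \<longrightarrow> v = 0)"

definition involutory_automorphism :: "('a::field \<Rightarrow> 'a) \<Rightarrow> bool" where
  "involutory_automorphism \<sigma> \<longleftrightarrow>
     (\<forall>x y. \<sigma> (x + y) = \<sigma> x + \<sigma> y) \<and> (\<forall>x y. \<sigma> (x * y) = \<sigma> x * \<sigma> y) \<and>
     (\<forall>x. \<sigma> (\<sigma> x) = x) \<and> (\<exists>x. \<sigma> x \<noteq> x)"

definition symplectic_form :: "('a::field ^ 'n \<Rightarrow> 'a ^ 'n \<Rightarrow> 'a) \<Rightarrow> bool" where
  "symplectic_form B \<longleftrightarrow> bilinear_form B \<and> nondegenerate B \<and> (\<forall>v. B v v = 0)"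

definition hermitian_form :: "('a::field ^ 'n \<Rightarrow> 'a ^ 'n \<Rightarrow> 'a) \<Rightarrow> bool" where
  "hermitian_form B \<longleftrightarrow>
     (\<exists>\<sigma>. involutory_automorphism \<sigma> \<and> sesquilinear_form \<sigma> B \<and> nondegenerate B \<and>
          (\<forall>u v. B v u = \<sigma> (B u v)))"

definition symmetric_form :: "('a::field ^ 'n \<Rightarrow> 'a ^ 'n \<Rightarrow> 'a) \<Rightarrow> bool" where
  "symmetric_form B \<longleftrightarrow> bilinear_form B \<and> nondegenerate B \<and> (\<forall>u v. B u v = B v u)"

definition induced_by ::
    "(('a::field ^ 'n) set \<Rightarrow> ('a ^ 'n) set) \<Rightarrow> ('a ^ 'n \<Rightarrow> 'a ^ 'n \<Rightarrow> 'a) \<Rightarrow> bool" where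
  "induced_by perp B \<longleftrightarrow> (\<forall>S. vec.subspace S \<longrightarrow> perp S = {v. \<forall>w\<in>S. B v w = 0})"

text \<open>
  For odd \<open>q\<close> the quadric \<open>B v v = 0\<close> of a nondegenerate symmetric bilinear form \<open>B\<close> is the set of
  vectors spanning isotropic points. Symmetric non-alternating forms in characteristic 2
  (pseudo-polarities) do not define a polar space and are excluded.
\<close>

definition classical_polarity :: "(('a::{field,finite} ^ 'n) set \<Rightarrow> ('a ^ 'n) set) \<Rightarrow> bool" where
  "classical_polarity perp \<longleftrightarrow> polarity perp \<and>
     (\<exists>B. induced_by perp B \<and>
        (symplectic_form B \<or> hermitian_form B \<or> (odd CARD('a) \<and> symmetric_form B)))"

subsection \<open>The polar space\<close>

definition totally_isotropic ::
    "(('a::field ^ 'n) set \<Rightarrow> ('a ^ 'n) set) \<Rightarrow> ('a ^ 'n) set \<Rightarrow> bool" where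
  "totally_isotropic perp S \<longleftrightarrow> vec.subspace S \<and> S \<subseteq> perp S"

definition maximal_totally_isotropic ::
    "(('a::field ^ 'n) set \<Rightarrow> ('a ^ 'n) set) \<Rightarrow> ('a ^ 'n) set \<Rightarrow> bool" where
  "maximal_totally_isotropic perp S \<longleftrightarrow> totally_isotropic perp S \<and>
     (\<forall>T. totally_isotropic perp T \<longrightarrow> S \<subseteq> T \<longrightarrow> T = S)"

text \<open>
  By Witt's theorem every classical polarity has exactly one rank in the following sense.
\<close>

definition has_rank :: "(('a::field ^ 'n) set \<Rightarrow> ('a ^ 'n) set) \<Rightarrow> nat \<Rightarrow> bool" where
  "has_rank perp d \<longleftrightarrow> (\<forall>S. maximal_totally_isotropic perp S \<longrightarrow> vec.dim S = d)"

definition points :: "('a::field ^ 'n) set \<Rightarrow> ('a ^ 'n) set set" where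
  "points S = {x. vec.subspace x \<and> vec.dim x = 1 \<and> x \<subseteq> S}"

definition collinearity_graph ::
    "(('a::field ^ 'n) set \<Rightarrow> ('a ^ 'n) set) \<Rightarrow> ('a ^ 'n) set pair_pre_digraph" where
  "collinearity_graph perp =
     (let V = {x \<in> points UNIV. totally_isotropic perp x}
      in \<lparr> pverts = V, parcs = {(x, y). x \<in> V \<and> y \<in> V \<and> x \<noteq> y \<and> x \<subseteq> perp y} \<rparr>)"

subsection \<open>Switching\<close>

text \<open>
  Following the convention of the graph library, an undirected simple graph is a symmetric loop-free
  digraph without parallel arcs (locale \<open>pair_graph\<close>).
\<close>

definition neighbourhood :: "'v pair_pre_digraph \<Rightarrow> 'v \<Rightarrow> 'v set" where
  "neighbourhood G x = {y. (x, y) \<in> parcs G}"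

definition regular :: "('v, 'e) pre_digraph \<Rightarrow> nat \<Rightarrow> bool" where
  "regular G k \<longleftrightarrow> (\<forall>v \<in> verts G. out_degree G v = k)"

definition switching_set :: "'v pair_pre_digraph \<Rightarrow> 'v set \<Rightarrow> 'v set \<Rightarrow> bool" where
  "switching_set G C1 C2 \<longleftrightarrow>
     C1 \<subseteq> pverts G \<and> C2 \<subseteq> pverts G \<and> C1 \<inter> C2 = {} \<and>
     card C1 = card C2 \<and>
     (\<exists>k. regular (with_proj G \<restriction> C1) k \<and> regular (with_proj G \<restriction> C2) k) \<and>
     (\<exists>l. regular (with_proj G \<restriction> (C1 \<union> C2)) l) \<and>
     (\<forall>x \<in> pverts G - (C1 \<union> C2).
        card (neighbourhood G x \<inter> C1) = card (neighbourhood G x \<inter> C2) \<or>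
        neighbourhood G x \<inter> (C1 \<union> C2) \<in> {C1, C2})"

definition switched_neighbours :: "'v pair_pre_digraph \<Rightarrow> 'v set \<Rightarrow> 'v set \<Rightarrow> 'v \<Rightarrow> 'v set" where
  "switched_neighbours G C1 C2 x =
     (let N = neighbourhood G x \<inter> (C1 \<union> C2)
      in if N = C2 then C1 else if N = C1 then C2 else N)"

definition switch :: "'v pair_pre_digraph \<Rightarrow> 'v set \<Rightarrow> 'v set \<Rightarrow> 'v pair_pre_digraph" where
  "switch G C1 C2 =
     (let C = C1 \<union> C2; D = pverts G - C
      in \<lparr> pverts = pverts G,
           parcs = {(x, y) \<in> parcs G. x \<in> C \<and> y \<in> C} \<union> {(x, y) \<in> parcs G. x \<in> D \<and> y \<in> D} \<union>
                   {(x, y). x \<in> D \<and> y \<in> switched_neighbours G C1 C2 x} \<union>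
                   {(y, x). x \<in> D \<and> y \<in> switched_neighbours G C1 C2 x} \<rparr>)"

lemma pair_graphI:
  assumes "finite (pverts G)" "parcs G \<subseteq> pverts G \<times> pverts G"
    and "\<And>x. (x, x) \<notin> parcs G" "sym (parcs G)"
  shows "pair_graph G"
proof
  show "finite (parcs G)"
    by (rule finite_subset[OF assms(2)]) (simp add: assms(1))
  show "symmetric (with_proj G)"
    using assms(4) by (simp add: symmetric_def)
  show "fst e \<in> pverts G" "snd e \<in> pverts G" "fst e \<noteq> snd e" if "e \<in> parcs G" for e
    using assms(2,3) that by (cases e; auto)+
qed (fact assms(1))

lemma pair_graph_collinearity_graph:
  fixes perp :: "('a::{field,finite} ^ 'n) set \<Rightarrow> ('a ^ 'n) set"
  assumes "polarity perp"
  shows "pair_graph (collinearity_graph perp)"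
proof (rule pair_graphI)
  have "y \<subseteq> perp x" if x: "vec.subspace x" and y: "vec.subspace y" and "x \<subseteq> perp y" for x y
  proof -
    have "vec.subspace (perp y)" "perp (perp y) = y"
      using assms y unfolding polarity_def by blast+
    then show ?thesis
      using assms x \<open>x \<subseteq> perp y\<close> unfolding polarity_def by blast
  qed
  then show "sym (parcs (collinearity_graph perp))"
    by (intro symI) (auto simp: collinearity_graph_def Let_def points_def)
qed (auto simp: collinearity_graph_def Let_def)

lemma pair_graph_switch:
  assumes "pair_graph G" "C1 \<subseteq> pverts G" "C2 \<subseteq> pverts G"
  shows "pair_graph (switch G C1 C2)"
proof -
  interpret pair_graph G by fact
  have sn: "y \<in> C1 \<union> C2" if "y \<in> switched_neighbours G C1 C2 x" for x y
    using that by (auto simp: switched_neighbours_def Let_def split: if_splits)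
  have V: "pverts (switch G C1 C2) = pverts G"
    by (simp add: switch_def Let_def)
  show ?thesis
  proof (rule pair_graphI, unfold V)
    show "finite (pverts G)" by (fact pair_finite_verts)
    show "parcs (switch G C1 C2) \<subseteq> pverts G \<times> pverts G"
      using assms(2,3) by (auto simp: switch_def Let_def dest!: sn)
    show "(x, x) \<notin> parcs (switch G C1 C2)" for x
      using pair_no_loops[of "(x, x)"] by (auto simp: switch_def Let_def dest: sn)
    have "(y, x) \<in> parcs G" if "(x, y) \<in> parcs G" for x y
      using pair_sym_arcs that by (simp add: symmetric_def sym_def)
    then show "sym (parcs (switch G C1 C2))"
      by (intro symI) (auto simp: switch_def Let_def)
  qed
qed

end

theory Submission
  imports Defs
begin

text \<open>
  Let \<open>M = L1 \<inter> L2\<close>. A point \<open>x\<close> outside \<open>C1 \<union> C2\<close> meets \<open>P\<close> in \<open>H = x\<^sup>\<bottom> \<inter> P\<close>. If \<open>H\<close> contains points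
  of both \<open>C1\<close> and \<open>C2\<close>, then choosing \<open>a \<in> L1 - M\<close> in \<open>H\<close> identifies the points of \<open>C1\<close> in \<open>H\<close> with
  the vectors of \<open>M \<inter> H\<close> via \<open>\<mu> \<mapsto> \<langle>a + \<mu>\<rangle>\<close>, and likewise for \<open>C2\<close>; if it meets exactly one of them,
  it contains that one entirely.

  For the second claim, maximal cliques of \<open>\<Gamma>\<close> are projective spaces and the neighbours of an outer
  vertex in such a clique form a subspace. Hence, if the traces of \<open>z\<close> and \<open>z'\<close> on a maximal clique
  agree, and are nonempty, off the trace of a third vertex \<open>u\<close>, then they agree. Switching destroys
  this: take a totally isotropic \<open>S = \<langle>L1, e\<rangle> \<noteq> P\<close> of the same dimension as \<open>P\<close>. The points of
  \<open>S - L1\<close> trade their neighbours \<open>C1\<close> for \<open>C2\<close>, so they form with the points of \<open>L2\<close> a maximal clique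
  of the switched graph. It is glued from pieces of two projective spaces, and there are \<open>z\<close>, \<open>z'\<close>
  with the same trace on \<open>S\<close> but different traces on \<open>L2\<close>; the trace of \<open>u \<in> C1\<close> is \<open>L2\<close>.
\<close>

section \<open>A graph invariant\<close>

definition maximal_clique :: "'v pair_pre_digraph \<Rightarrow> 'v set \<Rightarrow> bool" where
  "maximal_clique G K \<longleftrightarrow> K \<subseteq> pverts G \<and>
     (\<forall>x\<in>K. \<forall>y\<in>K. x \<noteq> y \<longrightarrow> (x, y) \<in> parcs G) \<and>
     (\<forall>x\<in>pverts G - K. \<exists>y\<in>K. (x, y) \<notin> parcs G)"

text \<open>
  In a projective space a subspace not contained in a subspace \<open>J\<close> is spanned by its points
  outside \<open>J\<close>. The following is what this says about the subspaces that outer vertices cut out of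
  a maximal clique.
\<close>

definition traces_determined_off_trace :: "'v pair_pre_digraph \<Rightarrow> bool" where
  "traces_determined_off_trace G \<longleftrightarrow>
     (\<forall>K u z z'. maximal_clique G K \<longrightarrow> u \<in> pverts G - K \<longrightarrow> z \<in> pverts G - K \<longrightarrow>
        z' \<in> pverts G - K \<longrightarrow>
        neighbourhood G z \<inter> K - neighbourhood G u = neighbourhood G z' \<inter> K - neighbourhood G u \<longrightarrow>
        neighbourhood G z \<inter> K - neighbourhood G u \<noteq> {} \<longrightarrow>
        neighbourhood G z \<inter> K = neighbourhood G z' \<inter> K)"

text \<open>The library's isomorphisms carry separate maps for vertices, arcs, tails and heads.
  Because \<open>with_proj\<close> fixes tail and head to be \<open>fst\<close> and
  \<open>snd\<close>, the arc map is the vertex map applied to both ends, which leaves a bijection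
  that preserves and reflects adjacency.\<close>

lemma digraph_iso_with_projE:
  assumes "digraph_iso (with_proj G) (with_proj H)"
  obtains f where "bij_betw f (pverts G) (pverts H)"
    and "\<And>x y. x \<in> pverts G \<Longrightarrow> y \<in> pverts G \<Longrightarrow> (f x, f y) \<in> parcs H \<longleftrightarrow> (x, y) \<in> parcs G"
proof -
  obtain h where h: "pre_digraph.digraph_isomorphism (with_proj G) h"
    and H: "with_proj H = app_iso h (with_proj G)"
    using assms unfolding digraph_iso_def by blast
  have inj: "inj_on (iso_verts h) (pverts G)" and wf: "wf_digraph (with_proj G)"
    and ends: "\<forall>a\<in>parcs G. iso_verts h (fst a) = iso_tail h (iso_arcs h a) \<and>
      iso_verts h (snd a) = iso_head h (iso_arcs h a)"
    using h unfolding pre_digraph.digraph_isomorphism_def by auto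
  have verts: "pverts H = iso_verts h ` pverts G" and arcs: "parcs H = iso_arcs h ` parcs G"
    and t: "iso_tail h = fst" and hd: "iso_head h = snd"
    using arg_cong[OF H, of verts] arg_cong[OF H, of arcs] arg_cong[OF H, of tail]
      arg_cong[OF H, of head] by auto
  have wfG: "fst e \<in> pverts G" "snd e \<in> pverts G" if "e \<in> parcs G" for e
    using wf_digraph.tail_in_verts[OF wf, of e] wf_digraph.head_in_verts[OF wf, of e] that by auto
  have arc: "iso_arcs h a = (iso_verts h (fst a), iso_verts h (snd a))" if "a \<in> parcs G" for a
    using ends that t hd by (simp add: prod_eq_iff)
  show thesis
  proof
    show "bij_betw (iso_verts h) (pverts G) (pverts H)"
      using inj verts by (simp add: bij_betw_def)
    fix x y assume x: "x \<in> pverts G" and y: "y \<in> pverts G"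
    show "(iso_verts h x, iso_verts h y) \<in> parcs H \<longleftrightarrow> (x, y) \<in> parcs G"
    proof
      assume "(iso_verts h x, iso_verts h y) \<in> parcs H"
      then obtain a where a: "a \<in> parcs G" "iso_verts h (fst a) = iso_verts h x"
        "iso_verts h (snd a) = iso_verts h y"
        using arc arcs by (auto simp: image_iff)
      then have "fst a = x" "snd a = y"
        using inj wfG[OF a(1)] x y by (auto dest: inj_onD)
      then show "(x, y) \<in> parcs G" using a(1) by auto
    next
      assume "(x, y) \<in> parcs G"
      then show "(iso_verts h x, iso_verts h y) \<in> parcs H" using arc arcs by force
    qed
  qed
qed

text \<open>The property speaks of vertices and adjacency only, so a configuration in
  \<open>H\<close> pulls back along the bijection to one in \<open>G\<close>.\<close>

lemma traces_determined_off_trace_iso: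
  assumes iso: "digraph_iso (with_proj G) (with_proj H)" and G: "traces_determined_off_trace G"
  shows "traces_determined_off_trace H"
  unfolding traces_determined_off_trace_def
proof (intro allI impI)
  obtain f where f: "bij_betw f (pverts G) (pverts H)"
    and arc: "\<And>x y. x \<in> pverts G \<Longrightarrow> y \<in> pverts G \<Longrightarrow> (f x, f y) \<in> parcs H \<longleftrightarrow> (x, y) \<in> parcs G"
    using digraph_iso_with_projE[OF iso] by blast
  fix K u z z'
  assume K: "maximal_clique H K"
    and u: "u \<in> pverts H - K" and z: "z \<in> pverts H - K" and z': "z' \<in> pverts H - K"
    and eq: "neighbourhood H z \<inter> K - neighbourhood H u = neighbourhood H z' \<inter> K - neighbourhood H u"
    and ne: "neighbourhood H z \<inter> K - neighbourhood H u \<noteq> {}"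
  \<comment> \<open>\<open>f\<close> is unconstrained outside \<open>pverts G\<close>, so the
    preimage of the clique is cut down to vertices.\<close>
  define J where "J = {x \<in> pverts G. f x \<in> K}"
  have KV: "K \<subseteq> pverts H" using K by (simp add: maximal_clique_def)
  have surj: "\<exists>x\<in>pverts G. y = f x" if "y \<in> pverts H" for y
    using f that by (auto simp: bij_betw_def)
  have inj: "f x = f y \<longleftrightarrow> x = y" if "x \<in> pverts G" "y \<in> pverts G" for x y
    using f that by (auto simp: bij_betw_def dest: inj_onD)
  obtain u0 z0 z0' where pre: "u0 \<in> pverts G - J" "u = f u0" "z0 \<in> pverts G - J" "z = f z0"
    "z0' \<in> pverts G - J" "z' = f z0'"
    using surj u z z' unfolding J_def by blast
  have J: "maximal_clique G J"
    unfolding maximal_clique_def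
  proof (intro conjI ballI impI)
    show "J \<subseteq> pverts G" by (auto simp: J_def)
    show "(x, y) \<in> parcs G" if "x \<in> J" "y \<in> J" "x \<noteq> y" for x y
      using K that inj[of x y] arc[of x y] by (auto simp: maximal_clique_def J_def)
    fix x assume x: "x \<in> pverts G - J"
    then have "f x \<in> pverts H - K" using f by (auto simp: J_def bij_betw_def)
    then obtain y where "y \<in> K" "(f x, y) \<notin> parcs H" using K by (meson maximal_clique_def)
    moreover obtain y0 where "y0 \<in> pverts G" "y = f y0" using surj KV \<open>y \<in> K\<close> by blast
    ultimately show "\<exists>y\<in>J. (x, y) \<notin> parcs G" using x arc[of x y0] by (auto simp: J_def)
  qed
  have nb: "x \<in> neighbourhood G v \<longleftrightarrow> f x \<in> neighbourhood H (f v)"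
    if "v \<in> pverts G" "x \<in> pverts G" for v x
    using arc that by (simp add: neighbourhood_def)
  have "neighbourhood G z0 \<inter> J - neighbourhood G u0 = neighbourhood G z0' \<inter> J - neighbourhood G u0"
    using eq pre nb by (auto simp: J_def)
  moreover have "neighbourhood G z0 \<inter> J - neighbourhood G u0 \<noteq> {}"
  proof -
    obtain y where y: "y \<in> neighbourhood H z \<inter> K - neighbourhood H u" using ne by blast
    then obtain y0 where "y0 \<in> pverts G" "y = f y0" using surj KV by blast
    then show ?thesis using y pre nb[of _ y0] by (auto simp: J_def)
  qed
  ultimately have J_eq: "neighbourhood G z0 \<inter> J = neighbourhood G z0' \<inter> J"
    using G J pre unfolding traces_determined_off_trace_def by blast
  have "y \<in> neighbourhood H z \<longleftrightarrow> y \<in> neighbourhood H z'" if y: "y \<in> K" for y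
  proof -
    obtain y0 where "y0 \<in> pverts G" "y = f y0" using surj KV y by blast
    then show ?thesis using y J_eq pre nb[of _ y0] by (auto simp: J_def)
  qed
  then show "neighbourhood H z \<inter> K = neighbourhood H z' \<inter> K" by blast
qed

section \<open>Regularity of cliques and arcs of the switched graph\<close>

lemma regular_induce_clique:
  assumes "finite C" and "\<And>x y. x \<in> C \<Longrightarrow> y \<in> C \<Longrightarrow> (x, y) \<in> parcs G \<longleftrightarrow> x \<noteq> y"
  shows "regular (with_proj G \<restriction> C) (card C - 1)"
  unfolding regular_def
proof
  fix v assume "v \<in> verts (with_proj G \<restriction> C)"
  then have v: "v \<in> C" by simp
  have "out_arcs (with_proj G \<restriction> C) v = Pair v ` (C - {v})"
    using assms(2) v by (auto simp: out_arcs_def image_iff)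
  then show "out_degree (with_proj G \<restriction> C) v = card C - 1"
    using v assms(1) by (simp add: out_degree_def card_image inj_on_def)
qed

lemma switched_neighbours_subset: "switched_neighbours G C1 C2 x \<subseteq> C1 \<union> C2"
  by (auto simp: switched_neighbours_def Let_def)

text \<open>Switching alters only arcs between \<open>C1 \<union> C2\<close> and the remaining
  vertices; in both directions these are read off at the end outside
  \<open>C1 \<union> C2\<close>.\<close>

lemma parcs_switch:
  shows "x \<in> C1 \<union> C2 \<Longrightarrow> y \<in> C1 \<union> C2 \<Longrightarrow> (x, y) \<in> parcs (switch G C1 C2) \<longleftrightarrow> (x, y) \<in> parcs G"
    and "x \<in> pverts G - (C1 \<union> C2) \<Longrightarrow> y \<in> pverts G - (C1 \<union> C2) \<Longrightarrow>
      (x, y) \<in> parcs (switch G C1 C2) \<longleftrightarrow> (x, y) \<in> parcs G"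
    and "x \<in> pverts G - (C1 \<union> C2) \<Longrightarrow> y \<in> C1 \<union> C2 \<Longrightarrow>
      (x, y) \<in> parcs (switch G C1 C2) \<longleftrightarrow> y \<in> switched_neighbours G C1 C2 x"
    and "x \<in> C1 \<union> C2 \<Longrightarrow> y \<in> pverts G - (C1 \<union> C2) \<Longrightarrow>
      (x, y) \<in> parcs (switch G C1 C2) \<longleftrightarrow> x \<in> switched_neighbours G C1 C2 y"
  using switched_neighbours_subset[of G C1 C2] by (auto simp: switch_def Let_def)

section \<open>Points and hyperplanes\<close>

lemma span_singleton_subset_iff:
  fixes v :: "'a::field ^ 'n"
  assumes "vec.subspace S"
  shows "vec.span {v} \<subseteq> S \<longleftrightarrow> v \<in> S"
  using assms vec.span_minimal[of "{v}" S] vec.span_superset[of "{v}"] by auto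

lemma mem_points_iff:
  fixes S :: "('a::field ^ 'n) set"
  assumes "vec.subspace S"
  shows "x \<in> points S \<longleftrightarrow> (\<exists>v\<in>S. v \<noteq> 0 \<and> x = vec.span {v})"
proof
  assume "x \<in> points S"
  then have x: "vec.subspace x" "vec.dim x = 1" "x \<subseteq> S" by (auto simp: points_def)
  obtain b where b: "b \<subseteq> x" "vec.independent b" "x \<subseteq> vec.span b" "card b = vec.dim x"
    by (rule vec.basis_exists)
  then obtain v where v: "b = {v}" using x(2) by (metis card_1_singletonE)
  then have "v \<noteq> 0" using b(2) by (auto simp: vec.dependent_def)
  moreover have "x = vec.span {v}" using b v x(1) vec.span_minimal[of b x] by auto
  ultimately show "\<exists>v\<in>S. v \<noteq> 0 \<and> x = vec.span {v}" using b v x(3) by auto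
next
  assume "\<exists>v\<in>S. v \<noteq> 0 \<and> x = vec.span {v}"
  then show "x \<in> points S"
    using span_singleton_subset_iff[OF assms] by (auto simp: points_def)
qed

lemma span_singleton_eqD:
  fixes v w :: "'a::field ^ 'n"
  assumes "vec.span {v} = vec.span {w}"
  shows "\<exists>c. v = c *s w"
proof -
  have "v \<in> vec.span {w}" using assms vec.span_superset[of "{v}"] by auto
  then show ?thesis by (auto simp: vec.span_singleton)
qed

text \<open>A vector \<open>a\<close> outside \<open>L\<close> raises the dimension by one, so
  \<open>L\<close> and \<open>a\<close> together already span \<open>P\<close>.\<close>

lemma hyperplane_decomp:
  fixes P L :: "('a::field ^ 'n) set"
  assumes P: "vec.subspace P" and L: "vec.subspace L" "L \<subseteq> P" and dim: "vec.dim P \<le> vec.dim L + 1"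
    and a: "a \<in> P" "a \<notin> L" and v: "v \<in> P"
  shows "\<exists>c. v - c *s a \<in> L"
proof -
  have L_span: "vec.span L = L" using L(1) by (rule vec.span_eq_iff[THEN iffD2])
  have "vec.span (insert a L) = P"
  proof (rule vec.subspace_dim_equal)
    show "vec.span (insert a L) \<subseteq> P" using a L P by (intro vec.span_minimal) auto
    show "vec.dim P \<le> vec.dim (vec.span (insert a L))"
      using dim a(2) unfolding vec.dim_span vec.dim_insert L_span by simp
  qed (use P in auto)
  then show ?thesis using v by (auto simp: vec.span_breakdown_eq L_span)
qed

text \<open>
  A point of \<open>L\<close> outside the hyperplane \<open>M\<close> has exactly one spanning vector in \<open>a + M\<close>.
\<close>

lemma card_points_off_hyperplane:
  fixes L M H :: "('a::field ^ 'n) set"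
  assumes L: "vec.subspace L" and M: "vec.subspace M" "M \<subseteq> L" and H: "vec.subspace H"
    and a: "a \<in> L" "a \<notin> M" "a \<in> H"
    and decomp: "\<And>v. v \<in> L \<Longrightarrow> \<exists>c. v - c *s a \<in> M"
  shows "card {x \<in> points L. \<not> x \<subseteq> M \<and> x \<subseteq> H} = card (M \<inter> H)"
proof -
  have off: "a + \<mu> \<notin> M" if "\<mu> \<in> M" for \<mu>
    using vec.subspace_diff[OF M(1), of "a + \<mu>" \<mu>] a that by auto
  have "bij_betw (\<lambda>\<mu>. vec.span {a + \<mu>}) (M \<inter> H) {x \<in> points L. \<not> x \<subseteq> M \<and> x \<subseteq> H}"
  proof (rule bij_betw_imageI)
    show "inj_on (\<lambda>\<mu>. vec.span {a + \<mu>}) (M \<inter> H)"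
    proof (rule inj_onI)
      fix \<mu> \<nu> assume \<mu>: "\<mu> \<in> M \<inter> H" and \<nu>: "\<nu> \<in> M \<inter> H" and "vec.span {a + \<mu>} = vec.span {a + \<nu>}"
      then obtain c where c: "a + \<mu> = c *s (a + \<nu>)" using span_singleton_eqD by blast
      \<comment> \<open>Comparing multiples of \<open>a\<close>: if \<open>c \<noteq> 1\<close>,
        then \<open>a\<close> would be a multiple of a vector of \<open>M\<close>.\<close>
      then have *: "(1 - c) *s a = c *s \<nu> - \<mu>" by (simp add: algebra_simps vector_sadd_rdistrib)
      have "c *s \<nu> - \<mu> \<in> M" using \<mu> \<nu> M by (intro vec.subspace_diff vec.subspace_scale) auto
      then have "inverse (1 - c) *s ((1 - c) *s a) \<in> M" using M * by (metis vec.subspace_scale)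
      then have "c = 1" using a by (cases "c = 1") (auto simp: vector_smult_assoc)
      then show "\<mu> = \<nu>" using c by simp
    qed
    show "(\<lambda>\<mu>. vec.span {a + \<mu>}) ` (M \<inter> H) = {x \<in> points L. \<not> x \<subseteq> M \<and> x \<subseteq> H}" (is "?l = ?r")
    proof (intro equalityI subsetI)
      fix x assume "x \<in> ?l"
      then obtain \<mu> where \<mu>: "\<mu> \<in> M" "\<mu> \<in> H" "x = vec.span {a + \<mu>}" by auto
      have "a + \<mu> \<in> L" "a + \<mu> \<in> H" using \<mu> a M L H by (auto intro!: vec.subspace_add)
      moreover have "a + \<mu> \<noteq> 0" using off[OF \<mu>(1)] vec.subspace_0[OF M(1)] by auto
      ultimately show "x \<in> ?r"
        using \<mu> off by (auto simp: mem_points_iff[OF L] span_singleton_subset_iff M H)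
    next
      fix x assume "x \<in> ?r"
      then have "x \<in> points L" and nM: "\<not> x \<subseteq> M" and xH: "x \<subseteq> H" by blast+
      then obtain v where v: "v \<in> L" "x = vec.span {v}" by (auto simp: mem_points_iff[OF L])
      then have v: "v \<in> L" "x = vec.span {v}" "v \<notin> M" "v \<in> H"
        using nM xH span_singleton_subset_iff[OF M(1)] span_singleton_subset_iff[OF H] by auto
      obtain c where c: "v - c *s a \<in> M" using decomp v by blast
      then have c0: "c \<noteq> 0" using v by auto
      \<comment> \<open>Rescaling \<open>v\<close> by \<open>inverse c\<close> makes its coefficient
        at \<open>a\<close> equal to 1, and \<open>\<mu>\<close> is the part that remains in
        \<open>M\<close>.\<close>
      define \<mu> where "\<mu> = inverse c *s (v - c *s a)"
      have \<mu>: "\<mu> \<in> M" "\<mu> \<in> H"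
        unfolding \<mu>_def using c M H v a by (auto intro!: vec.subspace_scale vec.subspace_diff)
      have am: "a + \<mu> = inverse c *s v"
        using c0 by (simp add: \<mu>_def vector_ssub_ldistrib vector_smult_assoc)
      then have va: "v = c *s (a + \<mu>)" using c0 by (simp add: vector_smult_assoc)
      have "c *s (a + \<mu>) \<in> vec.span {a + \<mu>}" "inverse c *s v \<in> vec.span {v}"
        by (intro vec.span_scale vec.span_base; simp)+
      then have "v \<in> vec.span {a + \<mu>}" "a + \<mu> \<in> vec.span {v}" by (metis va, metis am)
      then have "x = vec.span {a + \<mu>}" unfolding v(2)
        by (intro equalityI) (auto simp: span_singleton_subset_iff)
      then show "x \<in> ?l" using \<mu> by auto
    qed
  qed
  then show ?thesis by (simp add: bij_betw_same_card)
qed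


text \<open>Since \<open>L'\<close> is a hyperplane of \<open>P\<close>, the intersection
  \<open>L \<inter> L'\<close> is one of \<open>L\<close>, and the previous count applies. The value
  is symmetric in \<open>L\<close> and \<open>L'\<close>, which is what balances the two sides of
  the switching set.\<close>

lemma card_points_of_hyperplane_diff:
  fixes P L L' H :: "('a::field ^ 'n) set"
  assumes P: "vec.subspace P" and L: "vec.subspace L" "L \<subseteq> P"
    and L': "vec.subspace L'" "L' \<subseteq> P" "vec.dim P \<le> vec.dim L' + 1"
    and H: "vec.subspace H" and a: "a \<in> L" "a \<notin> L'" "a \<in> H"
  shows "card {x \<in> points L. \<not> x \<subseteq> L' \<and> x \<subseteq> H} = card (L \<inter> L' \<inter> H)"
proof -
  have "\<exists>c. v - c *s a \<in> L \<inter> L'" if v: "v \<in> L" for v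
  proof -
    obtain c where "v - c *s a \<in> L'"
      using hyperplane_decomp[OF P L' _ a(2)] L(2) a(1) v by blast
    then show ?thesis using L(1) a(1) v by (auto intro!: exI[of _ c] vec.subspace_diff vec.subspace_scale)
  qed
  then have "card {x \<in> points L. \<not> x \<subseteq> L \<inter> L' \<and> x \<subseteq> H} = card (L \<inter> L' \<inter> H)"
    using card_points_off_hyperplane[OF L(1) vec.subspace_inter[OF L(1) L'(1)] _ H a(1) _ a(3)] a(2)
    by blast
  moreover have "{x \<in> points L. \<not> x \<subseteq> L \<inter> L' \<and> x \<subseteq> H} = {x \<in> points L. \<not> x \<subseteq> L' \<and> x \<subseteq> H}"
    by (auto simp: points_def)
  ultimately show ?thesis by simp
qed

section \<open>Polar spaces\<close>

text \<open>The properties shared by the symplectic, Hermitian and symmetric cases. The last one is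
  geometric: a line through an isotropic point \<open>p\<close> that is not orthogonal to
  \<open>p\<close> carries a further isotropic point.\<close>

locale polar_form =
  fixes perp :: "('a::{field,finite} ^ 'n) set \<Rightarrow> ('a ^ 'n) set"
    and B :: "'a ^ 'n \<Rightarrow> 'a ^ 'n \<Rightarrow> 'a" and \<sigma> :: "'a \<Rightarrow> 'a"
  assumes polarity: "polarity perp" and induced: "induced_by perp B"
    and sesquilinear: "sesquilinear_form \<sigma> B"
    and reflexive: "B u v = 0 \<Longrightarrow> B v u = 0"
    and isotropic_on_line: "B p p = 0 \<Longrightarrow> B p w \<noteq> 0 \<Longrightarrow> \<exists>c. B (w + c *s p) (w + c *s p) = 0"

text \<open>Reflexivity comes from the symmetry type of the form. For the isotropic vector
  \<open>w + c *s p\<close> any \<open>c\<close> works in the alternating case; the Hermitian case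
  uses an element of nonzero trace, and the symmetric case divides by 2.\<close>

lemma classical_polarity_polar_form:
  fixes perp :: "('a::{field,finite} ^ 'n) set \<Rightarrow> ('a ^ 'n) set"
  assumes "classical_polarity perp"
  shows "\<exists>B \<sigma>. polar_form perp B \<sigma>"
proof -
  obtain B where pol: "polarity perp" and ind: "induced_by perp B"
    and B: "symplectic_form B \<or> hermitian_form B \<or> (odd CARD('a) \<and> symmetric_form B)"
    using assms by (auto simp: classical_polarity_def)
  consider "symplectic_form B" | "hermitian_form B" | "odd CARD('a)" "symmetric_form B" using B by blast
  then show ?thesis
  proof cases
    case 1
    then have alt: "B v v = 0" and s: "bilinear_form B" for v by (auto simp: symplectic_form_def)
    have skew: "B v u = - B u v" for u v
    proof -
      have "B (u + v) (u + v) = B u u + B u v + (B v u + B v v)"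
        using s by (simp add: sesquilinear_form_def)
      then show ?thesis using alt by (simp add: eq_neg_iff_add_eq_0 add.commute)
    qed
    have "B v u = 0" if "B u v = 0" for u v using skew[of v u] that by simp
    then have "polar_form perp B (\<lambda>c. c)" using pol ind s by unfold_locales (auto simp: alt)
    then show ?thesis by blast
  next
    case 2
    then obtain \<sigma> where \<sigma>: "involutory_automorphism \<sigma>" and s: "sesquilinear_form \<sigma> B"
      and herm: "\<And>u v. B v u = \<sigma> (B u v)" by (auto simp: hermitian_form_def)
    have add: "\<sigma> (x + y) = \<sigma> x + \<sigma> y" and mult: "\<sigma> (x * y) = \<sigma> x * \<sigma> y" and inv: "\<sigma> (\<sigma> x) = x" for x y
      using \<sigma> by (auto simp: involutory_automorphism_def)
    have zero: "\<sigma> 0 = 0" using add[of 0 0] by (metis add_0 add_cancel_right_right)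
    \<comment> \<open>If the trace vanished identically, \<open>\<sigma>\<close> would be negation;
      as it fixes 1, this gives \<open>- 1 = 1\<close>, and \<open>\<sigma>\<close> would be the
      identity.\<close>
    have "\<exists>t. t + \<sigma> t \<noteq> 0"
    proof (rule ccontr)
      assume "\<not> ?thesis"
      then have neg: "\<sigma> t = - t" for t by (simp add: eq_neg_iff_add_eq_0 add.commute)
      have "\<sigma> 1 = 1" using mult[of 1 1] inv[of 1] zero by (metis mult_cancel_right1 mult_1 zero_neq_one)
      then have "\<sigma> t = t" for t using neg mult[of t 1] neg[of 1] by (metis mult_1_right mult_minus_right minus_minus)
      then show False using \<sigma> by (auto simp: involutory_automorphism_def)
    qed
    then obtain t where t: "t + \<sigma> t \<noteq> 0" by blast
    have "\<exists>c. B (w + c *s p) (w + c *s p) = 0" if p: "B p p = 0" "B p w \<noteq> 0" for p w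
    proof -
      \<comment> \<open>Numerator and denominator are fixed by \<open>\<sigma>\<close>, hence so is
        \<open>r\<close>, and the trace of \<open>r * t\<close> is \<open>- B w w\<close>. The
        scalar \<open>c\<close> below is chosen so that \<open>c * B p w = r * t\<close>.\<close>
      define r where "r = - B w w / (t + \<sigma> t)"
      have "\<sigma> (B w w) = B w w" using herm by metis
      moreover have "\<sigma> (t + \<sigma> t) = t + \<sigma> t" by (simp add: add inv add.commute)
      moreover have "r * (t + \<sigma> t) = - B w w" using t by (simp add: r_def)
      moreover have "\<sigma> (- x) = - \<sigma> x" for x using add[of x "- x"] zero by (simp add: eq_neg_iff_add_eq_0 add.commute)
      ultimately have "\<sigma> r * (t + \<sigma> t) = r * (t + \<sigma> t)" using mult[of r "t + \<sigma> t"] by metis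
      then have r: "\<sigma> r = r" using t by simp
      define c where "c = r * t / B p w"
      have "B (w + c *s p) (w + c *s p) = B w w + \<sigma> c * B w p + (c * B p w + c * (\<sigma> c * B p p))"
        using s by (simp add: sesquilinear_form_def distrib_left)
      also have "\<sigma> c * B w p = \<sigma> (c * B p w)" using mult herm[of w p] by simp
      also have "c * B p w = r * t" using p by (simp add: c_def)
      also have "B w w + \<sigma> (r * t) + (r * t + c * (\<sigma> c * B p p)) = B w w + r * (t + \<sigma> t)"
        using p by (simp add: mult r algebra_simps)
      also have "\<dots> = 0" using t by (simp add: r_def)
      finally show ?thesis by blast
    qed
    moreover have "B v u = 0" if "B u v = 0" for u v using herm[of v u] that zero by simp
    ultimately have "polar_form perp B \<sigma>" using pol ind s by unfold_locales
    then show ?thesis by blast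
  next
    case 3
    then have s: "bilinear_form B" and sym: "\<And>u v. B u v = B v u" by (auto simp: symmetric_form_def)
    have two: "(2::'a) \<noteq> 0"
    proof
      assume two0: "(2::'a) = 0"
      \<comment> \<open>Translation by 1 permutes the field, so summing over the field shows that
        its order is 0 in the field; an odd order and \<open>2 = 0\<close> would then give
        \<open>1 = 0\<close>.\<close>
      have "(\<Sum>x\<in>UNIV. x + 1) = (\<Sum>x\<in>UNIV. x :: 'a)"
        by (rule sum.reindex_bij_witness[of _ "\<lambda>x. x - 1" "\<lambda>x. x + 1"]) auto
      then have "of_nat CARD('a) = (0 :: 'a)" by (simp add: sum.distrib)
      moreover obtain k where "CARD('a) = 2 * k + 1" using 3(1) by (auto elim: oddE)
      ultimately show False using two0 by simp
    qed
    have "\<exists>c. B (w + c *s p) (w + c *s p) = 0" if p: "B p p = 0" "B p w \<noteq> 0" for p w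
    proof (rule exI)
      \<comment> \<open>As \<open>p\<close> is isotropic, the quadratic term in \<open>c\<close>
        drops out and \<open>?c\<close> solves the linear equation that is left.\<close>
      let ?c = "- B w w / (2 * B p w)"
      have "B (w + c *s p) (w + c *s p) = B w w + c * B w p + (c * B p w + c * (c * B p p))" for c
        using s by (simp add: sesquilinear_form_def distrib_left)
      then have "B (w + ?c *s p) (w + ?c *s p) =
        B w w + ?c * B w p + (?c * B p w + ?c * (?c * B p p))" .
      also have "\<dots> = 0" using p two sym[of w p] by (simp add: field_simps)
      finally show "B (w + ?c *s p) (w + ?c *s p) = 0" .
    qed
    moreover have "B v u = 0" if "B u v = 0" for u v using sym[of v u] that by simp
    ultimately have "polar_form perp B (\<lambda>c. c)" using pol ind s by unfold_locales
    then show ?thesis by blast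
  qed
qed

context polar_form
begin

abbreviation (input) \<Gamma> where "\<Gamma> \<equiv> collinearity_graph perp"

section \<open>Orthogonality and totally isotropic subspaces\<close>

lemma form_add_left: "B (u + v) w = B u w + B v w"
  and form_add_right: "B w (u + v) = B w u + B w v"
  and form_scale_left: "B (c *s u) w = c * B u w"
  and form_scale_right: "B w (c *s u) = \<sigma> c * B w u"
  using sesquilinear by (auto simp: sesquilinear_form_def)

lemma form_zero_left: "B 0 w = 0" and form_zero_right: "B w 0 = 0"
  using form_add_left[of 0 0 w] form_add_right[of w 0 0] by (metis add_0 add_cancel_right_right)+

lemma orthogonal_sym: "B u v = 0 \<longleftrightarrow> B v u = 0"
  using reflexive by blast

lemma subspace_orthogonal: "vec.subspace {v. B v w = 0}"
  by (auto simp: vec.subspace_def form_zero_left form_add_left form_scale_left)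

lemma perp_eq: "vec.subspace S \<Longrightarrow> perp S = {v. \<forall>w\<in>S. B v w = 0}"
  using induced by (simp add: induced_by_def)

lemma perp_span_singleton: "perp (vec.span {w}) = {v. B v w = 0}"
proof -
  have "vec.subspace (vec.span {w})" by simp
  then have "perp (vec.span {w}) = {v. \<forall>u\<in>vec.span {w}. B v u = 0}" by (rule perp_eq)
  moreover have "w \<in> vec.span {w}" by (simp add: vec.span_base)
  moreover have "B v u = 0" if "B v w = 0" "u \<in> vec.span {w}" for u v
    using that by (auto simp: vec.span_singleton form_scale_right)
  ultimately show ?thesis by blast
qed

lemma totally_isotropic_iff:
  "totally_isotropic perp S \<longleftrightarrow> vec.subspace S \<and> (\<forall>u\<in>S. \<forall>v\<in>S. B u v = 0)"
  by (auto simp: totally_isotropic_def perp_eq)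

text \<open>Orthogonality passes from \<open>X\<close> to its span one argument at a time, with
  reflexivity exchanging the arguments in between.\<close>

lemma span_orthogonal:
  assumes "\<And>a b. a \<in> X \<Longrightarrow> b \<in> X \<Longrightarrow> B a b = 0" and "u \<in> vec.span X" and "v \<in> vec.span X"
  shows "B u v = 0"
proof -
  have "B a v = 0" if "a \<in> X" for a
  proof -
    have "vec.span X \<subseteq> {v. B v a = 0}"
      using assms(1) that by (intro vec.span_minimal subspace_orthogonal) auto
    then show ?thesis using assms(3) orthogonal_sym by blast
  qed
  then have "vec.span X \<subseteq> {u. B u v = 0}" by (intro vec.span_minimal subspace_orthogonal) auto
  then show ?thesis using assms(2) by blast
qed

text \<open>The span of \<open>X\<close> is its own double perp, so a vector outside it fails to be
  orthogonal to some vector of the perp.\<close>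

lemma exists_separating_orthogonal:
  assumes "p \<notin> vec.span X"
  shows "\<exists>w. (\<forall>x\<in>X. B x w = 0) \<and> B p w \<noteq> 0"
proof -
  have "vec.subspace (perp (vec.span X))" "perp (perp (vec.span X)) = vec.span X"
    using polarity vec.subspace_span unfolding polarity_def by blast+
  then obtain w where "w \<in> perp (vec.span X)" "B p w \<noteq> 0" using assms perp_eq by blast
  then have "\<forall>x\<in>vec.span X. B w x = 0" "B p w \<noteq> 0" by (auto simp: perp_eq)
  then show ?thesis using orthogonal_sym vec.span_base by metis
qed

text \<open>A separating vector \<open>w\<close> may be moved along \<open>p\<close> until it is
  isotropic: \<open>p\<close> is orthogonal to \<open>X\<close> and to itself, so no value
  \<open>B x w\<close> or \<open>B p w\<close> changes.\<close>

lemma exists_isotropic_separating_orthogonal: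
  assumes "p \<notin> vec.span X" and "B p p = 0" and "\<And>x. x \<in> X \<Longrightarrow> B x p = 0"
  shows "\<exists>w. B w w = 0 \<and> (\<forall>x\<in>X. B x w = 0) \<and> B p w \<noteq> 0"
proof -
  obtain w where w: "\<forall>x\<in>X. B x w = 0" "B p w \<noteq> 0" using exists_separating_orthogonal[OF assms(1)] by blast
  then obtain c where "B (w + c *s p) (w + c *s p) = 0" using isotropic_on_line assms(2) by blast
  then show ?thesis using w assms by (intro exI[of _ "w + c *s p"]) (simp add: form_add_right form_scale_right)
qed

text \<open>Adjoining \<open>v\<close> to \<open>S\<close> keeps it totally isotropic. By finiteness
  the result lies in a maximal totally isotropic subspace, which has the dimension of
  \<open>S\<close> and therefore equals \<open>S\<close>.\<close>

lemma mem_maximal_totally_isotropic: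
  assumes S: "totally_isotropic perp S" and rank: "has_rank perp (vec.dim S)"
    and v: "B v v = 0" "\<And>s. s \<in> S \<Longrightarrow> B v s = 0"
  shows "v \<in> S"
proof -
  let ?U = "vec.span (insert v S)"
  have "B a b = 0" if "a \<in> insert v S" "b \<in> insert v S" for a b
    using that S v orthogonal_sym unfolding totally_isotropic_iff by blast
  then have "totally_isotropic perp ?U"
    using span_orthogonal[of "insert v S"] by (auto simp: totally_isotropic_iff)
  then obtain U where U: "?U \<subseteq> U" "totally_isotropic perp U"
    "\<And>T. totally_isotropic perp T \<Longrightarrow> U \<subseteq> T \<Longrightarrow> U = T"
    using finite_has_maximal2[of "{T. totally_isotropic perp T}" ?U] by auto
  then have "maximal_totally_isotropic perp U" unfolding maximal_totally_isotropic_def by blast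
  then have "vec.dim U = vec.dim S" using rank by (simp add: has_rank_def)
  moreover have vS: "insert v S \<subseteq> U" using U(1) vec.span_superset by blast
  ultimately have "S = U"
    using S U by (intro vec.subspace_dim_equal) (auto simp: totally_isotropic_def)
  then show ?thesis using vS by blast
qed

section \<open>Vertices, adjacency and clique traces in the collinearity graph\<close>

lemma span_mem_pverts_iff: "v \<noteq> 0 \<Longrightarrow> vec.span {v} \<in> pverts \<Gamma> \<longleftrightarrow> B v v = 0"
  using span_singleton_subset_iff[OF subspace_orthogonal, of v v]
  by (auto simp: collinearity_graph_def mem_points_iff totally_isotropic_def perp_span_singleton)

lemma pverts_iff: "x \<in> pverts \<Gamma> \<longleftrightarrow> (\<exists>v. v \<noteq> 0 \<and> B v v = 0 \<and> x = vec.span {v})"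
proof
  assume x: "x \<in> pverts \<Gamma>"
  then obtain v where "v \<noteq> 0" "x = vec.span {v}"
    by (auto simp: collinearity_graph_def mem_points_iff)
  then show "\<exists>v. v \<noteq> 0 \<and> B v v = 0 \<and> x = vec.span {v}" using x span_mem_pverts_iff by blast
qed (use span_mem_pverts_iff in blast)

lemma parcs_span_iff:
  assumes "v \<noteq> 0" "w \<noteq> 0"
  shows "(vec.span {v}, vec.span {w}) \<in> parcs \<Gamma> \<longleftrightarrow>
    B v v = 0 \<and> B w w = 0 \<and> vec.span {v} \<noteq> vec.span {w} \<and> B v w = 0"
proof -
  have "(vec.span {v}, vec.span {w}) \<in> parcs \<Gamma> \<longleftrightarrow> vec.span {v} \<in> pverts \<Gamma> \<and>
      vec.span {w} \<in> pverts \<Gamma> \<and> vec.span {v} \<noteq> vec.span {w} \<and> vec.span {v} \<subseteq> perp (vec.span {w})"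
    by (auto simp: collinearity_graph_def)
  then show ?thesis
    using assms span_mem_pverts_iff span_singleton_subset_iff[OF subspace_orthogonal, of v w]
    by (simp add: perp_span_singleton)
qed

text \<open>The clique \<open>K\<close> consists of the points of a totally isotropic subspace
  \<open>W\<close>, and the trace of an outer vertex is the zero set on \<open>W\<close> of the form
  with one argument fixed. A common zero \<open>w0\<close> off the trace of \<open>u\<close> then
  transports the agreement to that trace.\<close>

lemma traces_determined_off_trace_collinearity_graph: "traces_determined_off_trace \<Gamma>"
  unfolding traces_determined_off_trace_def
proof (intro allI impI)
  fix K u z z'
  assume K: "maximal_clique \<Gamma> K"
    and u: "u \<in> pverts \<Gamma> - K" and z: "z \<in> pverts \<Gamma> - K" and z': "z' \<in> pverts \<Gamma> - K"
    and eq: "neighbourhood \<Gamma> z \<inter> K - neighbourhood \<Gamma> u = neighbourhood \<Gamma> z' \<inter> K - neighbourhood \<Gamma> u"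
    and ne: "neighbourhood \<Gamma> z \<inter> K - neighbourhood \<Gamma> u \<noteq> {}"
  define W where "W = vec.span {v. v \<noteq> 0 \<and> vec.span {v} \<in> K}"
  have isoK: "B v v = 0" if "v \<noteq> 0" "vec.span {v} \<in> K" for v
    using K that span_mem_pverts_iff by (auto simp: maximal_clique_def)
  have orth: "B v w = 0" if "v \<in> W" "w \<in> W" for v w
  proof (rule span_orthogonal[OF _ that[unfolded W_def]])
    fix a b assume a: "a \<in> {v. v \<noteq> 0 \<and> vec.span {v} \<in> K}" and b: "b \<in> {v. v \<noteq> 0 \<and> vec.span {v} \<in> K}"
    show "B a b = 0"
    proof (cases "vec.span {a} = vec.span {b}")
      case True
      then obtain c where "a = c *s b" using span_singleton_eqD by blast
      then show ?thesis using b isoK by (simp add: form_scale_left)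
    next
      case False
      then show ?thesis using K a b parcs_span_iff[of a b] by (auto simp: maximal_clique_def)
    qed
  qed
  \<comment> \<open>A point of \<open>W\<close> is orthogonal to all of \<open>K\<close>, so
    maximality of the clique forces it into \<open>K\<close>.\<close>
  have memK: "vec.span {w} \<in> K \<longleftrightarrow> w \<in> W" if w: "w \<noteq> 0" for w
  proof
    assume "vec.span {w} \<in> K"
    then show "w \<in> W" using w by (auto simp: W_def intro: vec.span_base)
  next
    assume W: "w \<in> W"
    show "vec.span {w} \<in> K"
    proof (rule ccontr)
      assume nK: "vec.span {w} \<notin> K"
      moreover have "vec.span {w} \<in> pverts \<Gamma>" using w W orth pverts_iff by blast
      ultimately obtain y where y: "y \<in> K" "(vec.span {w}, y) \<notin> parcs \<Gamma>"
        using K by (meson DiffI maximal_clique_def)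
      then obtain k where k: "k \<noteq> 0" "y = vec.span {k}"
        using K pverts_iff by (meson maximal_clique_def subsetD)
      then have "k \<in> W" using y by (auto simp: W_def intro: vec.span_base)
      then show False using y k nK w W orth parcs_span_iff by metis
    qed
  qed
  have nb: "vec.span {w} \<in> neighbourhood \<Gamma> (vec.span {v}) \<longleftrightarrow> B v w = 0"
    if "v \<noteq> 0" "vec.span {v} \<in> pverts \<Gamma> - K" "w \<noteq> 0" "w \<in> W" for v w
  proof -
    have "vec.span {v} \<noteq> vec.span {w}" using memK[of w] that by (metis DiffD2)
    moreover have "B v v = 0" using that span_mem_pverts_iff by blast
    ultimately show ?thesis using that orth parcs_span_iff by (auto simp: neighbourhood_def)
  qed
  have K_span: "\<exists>w. w \<noteq> 0 \<and> w \<in> W \<and> y = vec.span {w}" if y: "y \<in> K" for y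
  proof -
    have "y \<in> pverts \<Gamma>" using y K by (auto simp: maximal_clique_def)
    then obtain w where "w \<noteq> 0" "y = vec.span {w}" using pverts_iff by blast
    then show ?thesis using memK y by blast
  qed
  obtain \<upsilon> where \<upsilon>: "\<upsilon> \<noteq> 0" "u = vec.span {\<upsilon>}" using u pverts_iff by blast
  obtain w0 where w0: "w0 \<noteq> 0" "w0 \<in> W" "vec.span {w0} \<in> neighbourhood \<Gamma> z \<inter> K - neighbourhood \<Gamma> u"
    using ne K_span by blast
  have key: "neighbourhood \<Gamma> x \<inter> K \<subseteq> neighbourhood \<Gamma> x' \<inter> K"
    if x: "x \<in> pverts \<Gamma> - K" and x': "x' \<in> pverts \<Gamma> - K"
      and eq: "neighbourhood \<Gamma> x \<inter> K - neighbourhood \<Gamma> u = neighbourhood \<Gamma> x' \<inter> K - neighbourhood \<Gamma> u"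
      and w0x: "vec.span {w0} \<in> neighbourhood \<Gamma> x \<inter> K - neighbourhood \<Gamma> u" for x x'
  proof
    fix y assume y: "y \<in> neighbourhood \<Gamma> x \<inter> K"
    then obtain w where w: "w \<noteq> 0" "w \<in> W" "y = vec.span {w}" using K_span by blast
    obtain \<xi> where \<xi>: "\<xi> \<noteq> 0" "x = vec.span {\<xi>}" using x pverts_iff by blast
    obtain \<xi>' where \<xi>': "\<xi>' \<noteq> 0" "x' = vec.span {\<xi>'}" using x' pverts_iff by blast
    have eqW: "B \<xi> s = 0 \<longleftrightarrow> B \<xi>' s = 0" if "s \<noteq> 0" "s \<in> W" "B \<upsilon> s \<noteq> 0" for s
    proof -
      have "vec.span {s} \<in> neighbourhood \<Gamma> x \<inter> K - neighbourhood \<Gamma> u \<longleftrightarrow> B \<xi> s = 0"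
        using nb that memK \<xi> x u \<upsilon> by auto
      moreover have "vec.span {s} \<in> neighbourhood \<Gamma> x' \<inter> K - neighbourhood \<Gamma> u \<longleftrightarrow> B \<xi>' s = 0"
        using nb that memK \<xi>' x' u \<upsilon> by auto
      ultimately show ?thesis using eq by simp
    qed
    have 0: "B \<xi> w0 = 0" "B \<upsilon> w0 \<noteq> 0" "B \<xi> w = 0" using w0x w0 nb \<xi> x \<upsilon> u w y by auto
    have "B \<xi>' w = 0"
    proof (cases "B \<upsilon> w = 0")
      case True
      \<comment> \<open>Adding \<open>w0\<close> moves \<open>w\<close> off the trace of
        \<open>u\<close> while staying orthogonal to \<open>\<xi>\<close>, so the agreement applies
        to \<open>w + w0\<close> and to \<open>w0\<close>, hence to their difference.\<close>
      then have "B \<upsilon> (w + w0) \<noteq> 0" "B \<xi> (w + w0) = 0" using 0 by (auto simp: form_add_right)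
      moreover have "w + w0 \<in> W" using w w0 by (auto simp: W_def intro: vec.span_add)
      ultimately have "B \<xi>' (w + w0) = 0" using eqW[of "w + w0"] form_zero_right by metis
      moreover have "B \<xi>' w0 = 0" using eqW w0 0 by blast
      ultimately show ?thesis by (simp add: form_add_right)
    qed (use eqW w 0 in blast)
    then show "y \<in> neighbourhood \<Gamma> x' \<inter> K" using y w nb \<xi>' x' by auto
  qed
  show "neighbourhood \<Gamma> z \<inter> K = neighbourhood \<Gamma> z' \<inter> K"
  proof
    show "neighbourhood \<Gamma> z \<inter> K \<subseteq> neighbourhood \<Gamma> z' \<inter> K" using key[OF z z' eq w0(3)] .
    show "neighbourhood \<Gamma> z' \<inter> K \<subseteq> neighbourhood \<Gamma> z \<inter> K"
      using key[OF z' z eq[symmetric]] w0(3) eq by blast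
  qed
qed

text \<open>The zero set of \<open>v\<close> avoids \<open>L' - L\<close>, which forces it to
  contain \<open>L \<inter> L'\<close>; together with \<open>a\<close> this spans
  \<open>L\<close>.\<close>

lemma trace_contains_hyperplane:
  assumes P: "vec.subspace P" and L: "vec.subspace L" "L \<subseteq> P"
    and L': "vec.subspace L'" "L' \<subseteq> P" "vec.dim P \<le> vec.dim L' + 1"
    and a: "a \<in> L" "a \<notin> L'" "B a v = 0" and b: "b \<in> L'" "b \<notin> L"
    and avoid: "\<And>w. w \<in> L' \<Longrightarrow> w \<notin> L \<Longrightarrow> B w v \<noteq> 0" and w: "w \<in> L"
  shows "B w v = 0"
proof -
  obtain c where c: "w - c *s a \<in> L'"
    using hyperplane_decomp[OF P L' _ a(2)] L(2) a(1) w by blast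
  define g where "g = w - c *s a"
  have g: "g \<in> L" "g \<in> L'" unfolding g_def using c L(1) a(1) w by (auto intro!: vec.subspace_diff vec.subspace_scale)
  have "B g v = 0"
  proof (rule ccontr)
    assume g0: "B g v \<noteq> 0"
    \<comment> \<open>Chosen to cancel \<open>B b v\<close>: the vector \<open>b + k *s g\<close> is
      a zero lying in \<open>L'\<close> but, as \<open>g \<in> L\<close>, not in
      \<open>L\<close>.\<close>
    define k where "k = - B b v / B g v"
    have "b + k *s g \<in> L'" using g b L' by (auto intro!: vec.subspace_add vec.subspace_scale)
    moreover have "b + k *s g \<notin> L"
    proof
      assume "b + k *s g \<in> L"
      then have "(b + k *s g) - k *s g \<in> L" using g L(1) by (intro vec.subspace_diff vec.subspace_scale)
      then show False using b by simp
    qed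
    moreover have "B (b + k *s g) v = B b v + k * B g v" by (simp only: form_add_left form_scale_left)
    then have "B (b + k *s g) v = 0" using g0 by (simp add: k_def)
    ultimately show False using avoid by blast
  qed
  moreover have "w = g + c *s a" by (simp add: g_def)
  ultimately show ?thesis using a by (simp add: form_add_left form_scale_left)
qed

lemma neighbourhood_inter_points:
  assumes v: "v \<noteq> 0" "B v v = 0" and L: "vec.subspace L" "\<And>u. u \<in> L \<Longrightarrow> B u u = 0"
    and C: "C \<subseteq> points L" "vec.span {v} \<notin> C"
  shows "neighbourhood \<Gamma> (vec.span {v}) \<inter> C = {x \<in> C. x \<subseteq> {w. B w v = 0}}"
proof -
  have "x \<in> neighbourhood \<Gamma> (vec.span {v}) \<longleftrightarrow> x \<subseteq> {w. B w v = 0}" if x: "x \<in> C" for x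
  proof -
    obtain w where w: "w \<in> L" "w \<noteq> 0" "x = vec.span {w}" using x C(1) mem_points_iff[OF L(1)] by blast
    have "vec.span {v} \<noteq> vec.span {w}" using x w C(2) by metis
    then have "x \<in> neighbourhood \<Gamma> (vec.span {v}) \<longleftrightarrow> B v w = 0"
      using v w L(2) parcs_span_iff[of v w] by (simp add: neighbourhood_def)
    also have "\<dots> \<longleftrightarrow> x \<subseteq> {w. B w v = 0}"
      using w span_singleton_subset_iff[OF subspace_orthogonal, of w v] orthogonal_sym by simp
    finally show ?thesis .
  qed
  then show ?thesis by blast
qed

end

text \<open>The hyperplane condition is stated additively, avoiding truncated subtraction.\<close>

locale hyperplane_pair = polar_form perp B \<sigma>
  for perp :: "('a::{field,finite} ^ 'n) set \<Rightarrow> ('a ^ 'n) set" and B \<sigma> +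
  fixes P L1 L2 :: "('a ^ 'n) set"
  assumes P: "totally_isotropic perp P"
    and L1: "vec.subspace L1" "L1 \<subseteq> P" "vec.dim P = vec.dim L1 + 1"
    and L2: "vec.subspace L2" "L2 \<subseteq> P" "vec.dim P = vec.dim L2 + 1"
    and L1_neq_L2: "L1 \<noteq> L2"
begin

section \<open>The sets \<open>C1\<close> and \<open>C2\<close> and the switching property\<close>

definition C1 where "C1 = {x \<in> points L1. \<not> x \<subseteq> L2}"
definition C2 where "C2 = {x \<in> points L2. \<not> x \<subseteq> L1}"

lemma subspace_P: "vec.subspace P" and orthogonal_P: "u \<in> P \<Longrightarrow> v \<in> P \<Longrightarrow> B u v = 0"
  using P by (auto simp: totally_isotropic_iff)

lemma hyperplanes_incomparable: "\<exists>a. a \<in> L1 \<and> a \<notin> L2" "\<exists>b. b \<in> L2 \<and> b \<notin> L1"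
proof -
  have "\<not> L1 \<subseteq> L2" using vec.subspace_dim_equal[OF L1(1) L2(1)] L1(3) L2(3) L1_neq_L2 by auto
  then show "\<exists>a. a \<in> L1 \<and> a \<notin> L2" by blast
  have "\<not> L2 \<subseteq> L1" using vec.subspace_dim_equal[OF L2(1) L1(1)] L1(3) L2(3) L1_neq_L2 by auto
  then show "\<exists>b. b \<in> L2 \<and> b \<notin> L1" by blast
qed

lemma span_mem_C1_iff: "v \<noteq> 0 \<Longrightarrow> vec.span {v} \<in> C1 \<longleftrightarrow> v \<in> L1 \<and> v \<notin> L2"
  and span_mem_C2_iff: "v \<noteq> 0 \<Longrightarrow> vec.span {v} \<in> C2 \<longleftrightarrow> v \<in> L2 \<and> v \<notin> L1"
  using span_singleton_subset_iff[OF L1(1), of v] span_singleton_subset_iff[OF L2(1), of v]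
  by (auto simp: C1_def C2_def points_def)

lemma mem_C1E: assumes "x \<in> C1" obtains v where "v \<noteq> 0" "v \<in> L1" "v \<notin> L2" "x = vec.span {v}"
  using assms span_mem_C1_iff by (force simp: C1_def mem_points_iff[OF L1(1)])

lemma mem_C2E: assumes "x \<in> C2" obtains v where "v \<noteq> 0" "v \<in> L2" "v \<notin> L1" "x = vec.span {v}"
  using assms span_mem_C2_iff by (force simp: C2_def mem_points_iff[OF L2(1)])

lemma C1_C2_disjoint: "C1 \<inter> C2 = {}"
  by (auto simp: C1_def C2_def points_def)

lemma C1_nonempty: "C1 \<noteq> {}" and C2_nonempty: "C2 \<noteq> {}"
proof -
  obtain a b where "a \<in> L1" "a \<notin> L2" "b \<in> L2" "b \<notin> L1" using hyperplanes_incomparable by blast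
  moreover from this have "a \<noteq> 0" "b \<noteq> 0" using L1(1) L2(1) vec.subspace_0 by metis+
  ultimately show "C1 \<noteq> {}" "C2 \<noteq> {}" using span_mem_C1_iff span_mem_C2_iff by blast+
qed

lemma parcs_C_iff: "x \<in> C1 \<union> C2 \<Longrightarrow> y \<in> C1 \<union> C2 \<Longrightarrow> (x, y) \<in> parcs \<Gamma> \<longleftrightarrow> x \<noteq> y"
proof -
  have *: "\<exists>v. v \<noteq> 0 \<and> v \<in> P \<and> x = vec.span {v}" if "x \<in> C1 \<union> C2" for x
    using that L1(2) L2(2) by (blast elim: mem_C1E mem_C2E)
  assume "x \<in> C1 \<union> C2" "y \<in> C1 \<union> C2"
  then obtain v w where "v \<noteq> 0" "v \<in> P" "x = vec.span {v}" "w \<noteq> 0" "w \<in> P" "y = vec.span {w}"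
    using * by meson
  then show ?thesis using parcs_span_iff[of v w] orthogonal_P by simp
qed

lemma C_subset_pverts: "C1 \<union> C2 \<subseteq> pverts \<Gamma>"
proof
  fix x assume "x \<in> C1 \<union> C2"
  then obtain v where "v \<noteq> 0" "v \<in> P" "x = vec.span {v}"
    using L1(2) L2(2) by (blast elim: mem_C1E mem_C2E)
  then show "x \<in> pverts \<Gamma>" using pverts_iff orthogonal_P by blast
qed

text \<open>Both counts have the same value, so they agree as soon as \<open>H\<close> meets both
  \<open>L1 - L2\<close> and \<open>L2 - L1\<close>.\<close>

lemma card_C_inter:
  assumes H: "vec.subspace H"
  shows "a \<in> L1 \<Longrightarrow> a \<notin> L2 \<Longrightarrow> a \<in> H \<Longrightarrow> card {x \<in> C1. x \<subseteq> H} = card (L1 \<inter> L2 \<inter> H)"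
    and "b \<in> L2 \<Longrightarrow> b \<notin> L1 \<Longrightarrow> b \<in> H \<Longrightarrow> card {x \<in> C2. x \<subseteq> H} = card (L1 \<inter> L2 \<inter> H)"
  using card_points_of_hyperplane_diff[OF subspace_P L1(1,2) L2(1,2) _ H, of a] L2(3)
    card_points_of_hyperplane_diff[OF subspace_P L2(1,2) L1(1,2) _ H, of b] L1(3)
  by (simp_all add: C1_def C2_def conj_assoc Int_commute)

text \<open>\<open>C1 \<union> C2\<close> is a clique because \<open>P\<close> is totally isotropic,
  whence the regularity. For an outer vertex the cases are whether its perp meets
  \<open>L1 - L2\<close>, \<open>L2 - L1\<close>, both or neither.\<close>

lemma switching_set: "switching_set \<Gamma> C1 C2"
  unfolding switching_set_def
proof (intro conjI ballI)
  show "C1 \<subseteq> pverts \<Gamma>" "C2 \<subseteq> pverts \<Gamma>" using C_subset_pverts by auto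
  show "C1 \<inter> C2 = {}" by (fact C1_C2_disjoint)
  \<comment> \<open>With \<open>H\<close> the whole space, \<open>a\<close> and \<open>b\<close>
    also give the equality of the full cardinalities.\<close>
  obtain a b where a: "a \<in> L1" "a \<notin> L2" and b: "b \<in> L2" "b \<notin> L1"
    using hyperplanes_incomparable by blast
  show card: "card C1 = card C2" using card_C_inter[of UNIV] a b by simp
  show "\<exists>k. regular (with_proj \<Gamma> \<restriction> C1) k \<and> regular (with_proj \<Gamma> \<restriction> C2) k"
    using regular_induce_clique[of C1 \<Gamma>] regular_induce_clique[of C2 \<Gamma>] parcs_C_iff card by auto
  show "\<exists>l. regular (with_proj \<Gamma> \<restriction> (C1 \<union> C2)) l"
    using regular_induce_clique[of "C1 \<union> C2" \<Gamma>] parcs_C_iff by auto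
  fix x assume x: "x \<in> pverts \<Gamma> - (C1 \<union> C2)"
  then obtain v where v: "v \<noteq> 0" "B v v = 0" "x = vec.span {v}" using pverts_iff by blast
  let ?H = "{w. B w v = 0}"
  have N1: "neighbourhood \<Gamma> x \<inter> C1 = {y \<in> C1. y \<subseteq> ?H}"
    unfolding v(3) using v x L1 orthogonal_P
    by (intro neighbourhood_inter_points[where L = L1]) (auto simp: C1_def)
  have N2: "neighbourhood \<Gamma> x \<inter> C2 = {y \<in> C2. y \<subseteq> ?H}"
    unfolding v(3) using v x L2 orthogonal_P
    by (intro neighbourhood_inter_points[where L = L2]) (auto simp: C2_def)
  have full1: "{y \<in> C1. y \<subseteq> ?H} = C1" if "\<And>w. w \<in> L1 \<Longrightarrow> B w v = 0"
    using that by (auto simp: C1_def points_def)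
  have full2: "{y \<in> C2. y \<subseteq> ?H} = C2" if "\<And>w. w \<in> L2 \<Longrightarrow> B w v = 0"
    using that by (auto simp: C2_def points_def)
  have empty1: "{y \<in> C1. y \<subseteq> ?H} = {}" if "\<And>w. w \<in> L1 \<Longrightarrow> w \<notin> L2 \<Longrightarrow> B w v \<noteq> 0"
    using that span_singleton_subset_iff[OF subspace_orthogonal] by (blast elim: mem_C1E)
  have empty2: "{y \<in> C2. y \<subseteq> ?H} = {}" if "\<And>w. w \<in> L2 \<Longrightarrow> w \<notin> L1 \<Longrightarrow> B w v \<noteq> 0"
    using that span_singleton_subset_iff[OF subspace_orthogonal] by (blast elim: mem_C2E)
  have dims: "vec.dim P \<le> vec.dim L1 + 1" "vec.dim P \<le> vec.dim L2 + 1" using L1(3) L2(3) by auto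
  show "card (neighbourhood \<Gamma> x \<inter> C1) = card (neighbourhood \<Gamma> x \<inter> C2) \<or>
    neighbourhood \<Gamma> x \<inter> (C1 \<union> C2) \<in> {C1, C2}"
  proof (cases "\<exists>w. w \<in> L1 \<and> w \<notin> L2 \<and> B w v = 0")
    case True
    then obtain a' where a': "a' \<in> L1" "a' \<notin> L2" "B a' v = 0" by blast
    show ?thesis
    proof (cases "\<exists>w. w \<in> L2 \<and> w \<notin> L1 \<and> B w v = 0")
      case True
      then obtain b' where b': "b' \<in> L2" "b' \<notin> L1" "B b' v = 0" by blast
      have "card {y \<in> C1. y \<subseteq> ?H} = card {y \<in> C2. y \<subseteq> ?H}"
        using card_C_inter[OF subspace_orthogonal, of _ v] a' b' by simp
      then show ?thesis unfolding N1 N2 by blast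
    next
      case False
      then have "B w v = 0" if "w \<in> L1" for w
        using trace_contains_hyperplane[OF subspace_P L1(1,2) L2(1,2) dims(2) a' b _ that] by blast
      then have "neighbourhood \<Gamma> x \<inter> (C1 \<union> C2) = C1"
        unfolding Int_Un_distrib N1 N2 using full1 empty2 False by blast
      then show ?thesis by simp
    qed
  next
    case no1: False
    show ?thesis
    proof (cases "\<exists>w. w \<in> L2 \<and> w \<notin> L1 \<and> B w v = 0")
      case True
      then obtain b' where b': "b' \<in> L2" "b' \<notin> L1" "B b' v = 0" by blast
      have "B w v = 0" if "w \<in> L2" for w
        using trace_contains_hyperplane[OF subspace_P L2(1,2) L1(1,2) dims(1) b' a _ that] no1 by blast
      then have "neighbourhood \<Gamma> x \<inter> (C1 \<union> C2) = C2"
        unfolding Int_Un_distrib N1 N2 using full2 empty1 no1 by blast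
      then show ?thesis by simp
    next
      case False
      then have "{y \<in> C1. y \<subseteq> ?H} = {}" "{y \<in> C2. y \<subseteq> ?H} = {}" using empty1 empty2 no1 by blast+
      then have "card {y \<in> C1. y \<subseteq> ?H} = card {y \<in> C2. y \<subseteq> ?H}" by (simp only:)
      then show ?thesis unfolding N1 N2 by blast
    qed
  qed
qed

text \<open>The rank condition makes \<open>S\<close> maximal totally isotropic and thereby
  \<open>K\<close> a maximal clique. Dimension at least 3 provides a nonzero \<open>p\<close> in
  \<open>L1 \<inter> L2\<close>, by which the two separated vectors \<open>f\<close> and
  \<open>f + p\<close> differ.\<close>

lemma not_traces_determined_off_trace_switch:
  assumes rank: "has_rank perp (vec.dim P)" and dim: "3 \<le> vec.dim P"
  shows "\<not> traces_determined_off_trace (switch \<Gamma> C1 C2)"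
proof
  let ?G = "switch \<Gamma> C1 C2"
  let ?sp = "\<lambda>v. vec.span {v}"
  assume G: "traces_determined_off_trace ?G"

  \<comment> \<open>The second totally isotropic subspace through \<open>L1\<close>\<close>
  obtain a f where a: "a \<in> L1" "a \<notin> L2" and f: "f \<in> L2" "f \<notin> L1"
    using hyperplanes_incomparable by blast
  have a0: "a \<noteq> 0" using a L2(1) vec.subspace_0 by metis
  have f0: "w \<noteq> 0" if "w \<notin> L1" for w using that L1(1) vec.subspace_0 by metis

  \<comment> \<open>If the intersection were zero, \<open>L1\<close> would be spanned by
    \<open>a\<close>, although its dimension is at least 2.\<close>
  have "\<exists>p\<in>L1 \<inter> L2. p \<noteq> 0"
  proof (rule ccontr)
    assume none: "\<not> ?thesis"
    have "v \<in> vec.span {a}" if v: "v \<in> L1" for v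
    proof -
      obtain c where c: "v - c *s a \<in> L2"
        using hyperplane_decomp[OF subspace_P L2(1,2) _ _ a(2)] L2(3) L1(2) a(1) v by auto
      moreover have "v - c *s a \<in> L1" using v a L1(1) by (intro vec.subspace_diff vec.subspace_scale)
      ultimately have "v - c *s a = 0" using none by blast
      then have "v = c *s a" by simp
      then show ?thesis by (auto simp: vec.span_singleton)
    qed
    then have "vec.dim L1 \<le> card {a}" by (intro vec.dim_le_card) auto
    then show False using dim L1(3) by simp
  qed
  then obtain p where p: "p \<in> L1" "p \<in> L2" "p \<noteq> 0" by blast

  have span_L1: "vec.span L1 = L1" using L1(1) by simp
  have fP: "f \<in> P" using f L2(2) by blast
  have "\<exists>e. B e e = 0 \<and> (\<forall>l\<in>L1. B l e = 0) \<and> B f e \<noteq> 0"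
  proof (rule exists_isotropic_separating_orthogonal)
    show "f \<notin> vec.span L1" unfolding span_L1 by (fact f(2))
    show "B l f = 0" if "l \<in> L1" for l using that fP orthogonal_P L1(2) by blast
  qed (use fP orthogonal_P in blast)
  then obtain e where e: "B e e = 0" "\<And>l. l \<in> L1 \<Longrightarrow> B l e = 0" "B f e \<noteq> 0" by blast
  \<comment> \<open>The perp of \<open>e\<close> meets \<open>P\<close> exactly in
    \<open>L1\<close>, because \<open>P\<close> is spanned by \<open>L1\<close> and
    \<open>f\<close>, and \<open>f\<close> is not orthogonal to \<open>e\<close>.\<close>
  have P_e: "B v e = 0 \<longleftrightarrow> v \<in> L1" if v: "v \<in> P" for v
  proof
    assume ve: "B v e = 0"
    obtain c where c: "v - c *s f \<in> L1"
      using hyperplane_decomp[OF subspace_P L1(1,2) _ _ f(2) v] L1(3) L2(2) f(1) by auto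
    have "B v e = B (v - c *s f) e + c * B f e" by (simp flip: form_add_left form_scale_left)
    then have "c = 0" using ve e c by simp
    then show "v \<in> L1" using c by simp
  qed (fact e(2))
  have eP: "e \<notin> P" using orthogonal_P e(3) f(1) L2(2) by blast

  define S where "S = vec.span (insert e L1)"
  have S_iff: "v \<in> S \<longleftrightarrow> (\<exists>k. v - k *s e \<in> L1)" for v
    unfolding S_def vec.span_breakdown_eq span_L1 ..
  have S: "vec.subspace S" by (simp add: S_def)
  have L1S: "L1 \<subseteq> S" and eS: "e \<in> S" by (auto simp: S_def intro: vec.span_base)
  have orth_S: "B u v = 0" if "u \<in> S" "v \<in> S" for u v
  proof (rule span_orthogonal[OF _ that[unfolded S_def]])
    show "B x y = 0" if "x \<in> insert e L1" "y \<in> insert e L1" for x y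
      using that e orthogonal_sym[of e] orthogonal_P L1(2) by blast
  qed
  have PS: "v \<in> L1" if "v \<in> P" "v \<in> S" for v using P_e that orth_S eS by blast
  have "vec.dim S = vec.dim P"
    using eP L1(2,3) unfolding S_def vec.dim_span vec.dim_insert span_L1 by auto
  then have S_max: "v \<in> S" if "B v v = 0" "\<And>s. s \<in> S \<Longrightarrow> B v s = 0" for v
    using mem_maximal_totally_isotropic[of S v] that rank S orth_S by (simp add: totally_isotropic_iff)

  \<comment> \<open>Two vertices with equal traces on \<open>S\<close>\<close>
  obtain Bs where Bs: "{p} \<subseteq> Bs" "Bs \<subseteq> L1" "vec.independent Bs" "L1 \<subseteq> vec.span Bs"
    using vec.maximal_independent_subset_extend[of "{p}" L1] p by auto
  \<comment> \<open>A hyperplane of \<open>L1\<close> that avoids \<open>p\<close>, obtained by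
    deleting \<open>p\<close> from a basis of \<open>L1\<close>.\<close>
  define A where "A = vec.span (Bs - {p})"
  have A: "vec.subspace A" "A \<subseteq> L1" "p \<notin> A"
    using Bs L1(1) vec.span_minimal[of "Bs - {p}" L1] by (auto simp: A_def vec.dependent_def)
  have A_span: "vec.span A = A" using A(1) by simp
  have A_decomp: "\<exists>c. v - c *s p \<in> A" if "v \<in> L1" for v
  proof -
    have "v \<in> vec.span (insert p (Bs - {p}))" using that Bs by (auto simp: insert_absorb)
    then show ?thesis unfolding A_def vec.span_breakdown_eq .
  qed

  \<comment> \<open>Applied to \<open>g = f\<close> and \<open>g = f + p\<close>: both results cut out \<open>\<langle>A, e\<rangle>\<close> on \<open>S\<close>, but they separate
    \<open>f\<close> and \<open>f + p\<close> on \<open>L2\<close>.\<close>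
  have exz: "\<exists>z. B z z = 0 \<and> (\<forall>a\<in>A. B a z = 0) \<and> B e z = 0 \<and> B g z = 0 \<and> B p z \<noteq> 0"
    if g: "g \<in> L2" "g \<notin> L1" for g
  proof -
    \<comment> \<open>In a dependency the coefficient of \<open>e\<close> vanishes since
      \<open>e \<notin> P\<close>, then that of \<open>g\<close> since \<open>g \<notin> L1\<close>,
      and \<open>p \<in> A\<close> is left, which is excluded.\<close>
    have "p \<notin> vec.span (insert e (insert g A))"
    proof
      assume "p \<in> vec.span (insert e (insert g A))"
      then obtain k l where kl: "p - k *s e - l *s g \<in> A"
        unfolding vec.span_breakdown_eq A_span by blast
      have pg: "p \<in> P" "g \<in> P" using p g L1(2) L2(2) by auto
      have "k = 0"
      proof (rule ccontr)
        assume k: "k \<noteq> 0"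
        have "p - l *s g \<in> P" using pg subspace_P by (simp add: vec.subspace_diff vec.subspace_scale)
        moreover have "p - k *s e - l *s g \<in> P" using kl A(2) L1(2) by blast
        ultimately have "p - l *s g - (p - k *s e - l *s g) \<in> P"
          by (rule vec.subspace_diff[OF subspace_P])
        then have "k *s e \<in> P" by simp
        then show False using vec.subspace_scale[OF subspace_P, of "k *s e" "inverse k"] k eP by simp
      qed
      moreover have "l = 0"
      proof (rule ccontr)
        assume l: "l \<noteq> 0"
        have "p - k *s e - l *s g \<in> L1" using kl A(2) by blast
        then have "p - (p - k *s e - l *s g) \<in> L1" 
          by (rule vec.subspace_diff[OF L1(1) p(1)])
        then have "l *s g \<in> L1" using \<open>k = 0\<close> by simp
        then show False using vec.subspace_scale[OF L1(1), of "l *s g" "inverse l"] l g by simp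
      qed
      ultimately show False using kl A(3) by simp
    qed
    moreover have "B p p = 0" using orthogonal_P p L1(2) by blast
    moreover have "B x p = 0" if "x \<in> insert e (insert g A)" for x
      using that p g A(2) L1(2) L2(2) orthogonal_P e(2) orthogonal_sym by blast
    ultimately have "\<exists>z. B z z = 0 \<and> (\<forall>x\<in>insert e (insert g A). B x z = 0) \<and> B p z \<noteq> 0"
      by (rule exists_isotropic_separating_orthogonal)
    then show ?thesis by blast
  qed
  have fp: "f + p \<in> L2" "f + p \<notin> L1"
    using f p L2(1) vec.subspace_add vec.subspace_diff[OF L1(1), of "f + p" p] by auto
  obtain z where z: "B z z = 0" "\<And>a. a \<in> A \<Longrightarrow> B a z = 0" "B e z = 0" "B f z = 0" "B p z \<noteq> 0"
    using exz[OF f] by blast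
  obtain z' where z': "B z' z' = 0" "\<And>a. a \<in> A \<Longrightarrow> B a z' = 0" "B e z' = 0" "B (f + p) z' = 0" "B p z' \<noteq> 0"
    using exz[OF fp] by blast
  \<comment> \<open>The zeros of \<open>y\<close> in \<open>S\<close> form the span of
    \<open>A\<close> and \<open>e\<close>, whatever \<open>y\<close> is; this makes \<open>z\<close>
    and \<open>z'\<close> agree on \<open>S\<close>.\<close>
  have S_p: "B s y = 0 \<longleftrightarrow> (\<exists>k. s - k *s e \<in> A)"
    if s: "s \<in> S" and y: "\<And>a. a \<in> A \<Longrightarrow> B a y = 0" "B e y = 0" "B p y \<noteq> 0" for s y
  proof
    assume sy: "B s y = 0"
    obtain k where "s - k *s e \<in> L1" using s S_iff by blast
    then obtain c where c: "s - k *s e - c *s p \<in> A" using A_decomp by blast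
    have "B s y = B (s - k *s e - c *s p) y + k * B e y + c * B p y"
      by (simp flip: form_add_left form_scale_left)
    then have "c = 0" using sy c y by simp
    then show "\<exists>k. s - k *s e \<in> A" using c by auto
  next
    assume "\<exists>k. s - k *s e \<in> A"
    then obtain k where k: "s - k *s e \<in> A" by blast
    have "B s y = B (s - k *s e) y + k * B e y" by (simp flip: form_add_left form_scale_left)
    then show "B s y = 0" using y k by simp
  qed
  have z_out: "y \<noteq> 0 \<and> y \<notin> P \<and> y \<notin> S" if "B p y \<noteq> 0" for y
    using that orthogonal_P orth_S p L1(2) L1S form_zero_right by blast

  \<comment> \<open>Adjacency in the switched graph\<close>
  let ?D = "pverts \<Gamma> - (C1 \<union> C2)"
  have D_iff: "?sp v \<in> ?D \<longleftrightarrow> B v v = 0 \<and> (v \<in> L1 \<longleftrightarrow> v \<in> L2)" if "v \<noteq> 0" for v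
    using that span_mem_pverts_iff span_mem_C1_iff span_mem_C2_iff by blast
  have DD: "(?sp v, ?sp w) \<in> parcs ?G \<longleftrightarrow> ?sp v \<noteq> ?sp w \<and> B v w = 0"
    if "v \<noteq> 0" "?sp v \<in> ?D" "w \<noteq> 0" "?sp w \<in> ?D" for v w
    using parcs_switch(2)[OF that(2,4)] parcs_span_iff[OF that(1,3)] that D_iff by auto
  have N_iff: "?sp w \<in> neighbourhood \<Gamma> (?sp v) \<longleftrightarrow> B v w = 0"
    if "v \<noteq> 0" "?sp v \<in> ?D" "w \<noteq> 0" "?sp w \<in> C1 \<union> C2" for v w
  proof -
    have "B v v = 0" "B w w = 0" "?sp v \<noteq> ?sp w"
      using that C_subset_pverts span_mem_pverts_iff by auto
    then show ?thesis using parcs_span_iff[OF that(1,3)] by (simp add: neighbourhood_def)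
  qed
  have SD: "?sp v \<in> ?D" if "v \<in> S" "v \<notin> L1" for v
    using that D_iff f0 orth_S PS L2(2) by blast
  have MD: "?sp v \<in> ?D" if "v \<in> L1" "v \<in> L2" "v \<noteq> 0" for v
    using that D_iff orthogonal_P L1(2) by blast
  \<comment> \<open>Such a \<open>v\<close> is a vector of \<open>L1\<close> plus a nonzero multiple
    of \<open>e\<close>, and \<open>L1\<close> is orthogonal to all of \<open>P\<close>.\<close>
  have S_orth_P: "B v w = 0 \<longleftrightarrow> w \<in> L1" if v: "v \<in> S" "v \<notin> L1" and w: "w \<in> P" for v w
  proof
    assume vw: "B v w = 0"
    obtain k where k: "v - k *s e \<in> L1" using v(1) S_iff by blast
    then have k0: "k \<noteq> 0" using v(2) by auto
    have "B v w = B (v - k *s e) w + k * B e w" by (simp flip: form_add_left form_scale_left)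
    moreover have "B (v - k *s e) w = 0" using k w orthogonal_P L1(2) by blast
    ultimately have "B e w = 0" using vw k0 by simp
    then show "w \<in> L1" using P_e w orthogonal_sym by blast
  qed (use orth_S v L1S in blast)
  have swS: "switched_neighbours \<Gamma> C1 C2 (?sp v) = C2" if v: "v \<in> S" "v \<notin> L1" for v
  proof -
    have v0: "v \<noteq> 0" using f0 v by blast
    have "x \<in> neighbourhood \<Gamma> (?sp v)" if x: "x \<in> C1" for x
    proof -
      obtain w where w: "w \<noteq> 0" "w \<in> L1" "w \<notin> L2" "x = ?sp w" using x by (rule mem_C1E)
      then have "x \<in> neighbourhood \<Gamma> (?sp v) \<longleftrightarrow> B v w = 0" using N_iff[OF v0 SD[OF v] w(1)] x by blast
      then show ?thesis using S_orth_P[OF v, of w] w(2,3) L1(2) by blast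
    qed
    moreover have "x \<notin> neighbourhood \<Gamma> (?sp v)" if x: "x \<in> C2" for x
    proof -
      obtain w where w: "w \<noteq> 0" "w \<in> L2" "w \<notin> L1" "x = ?sp w" using x by (rule mem_C2E)
      then have "x \<in> neighbourhood \<Gamma> (?sp v) \<longleftrightarrow> B v w = 0" using N_iff[OF v0 SD[OF v] w(1)] x by blast
      then show ?thesis using S_orth_P[OF v, of w] w(2,3) L2(2) by blast
    qed
    ultimately have "neighbourhood \<Gamma> (?sp v) \<inter> (C1 \<union> C2) = C1" by blast
    \<comment> \<open>The definition tests for \<open>C2\<close> first; disjointness and
      nonemptiness rule out \<open>C1 = C2\<close>.\<close>
    then show ?thesis
      using C1_C2_disjoint C1_nonempty by (auto simp: switched_neighbours_def Let_def)
  qed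
  \<comment> \<open>Points of \<open>L1 \<inter> L2\<close> see all of
    \<open>C1 \<union> C2\<close>, which is neither \<open>C1\<close> nor \<open>C2\<close>, so
    switching leaves their neighbours alone.\<close>
  have swM: "switched_neighbours \<Gamma> C1 C2 (?sp v) = C1 \<union> C2"
    if v: "v \<in> L1" "v \<in> L2" "v \<noteq> 0" for v
  proof -
    have "x \<in> neighbourhood \<Gamma> (?sp v)" if "x \<in> C1 \<union> C2" for x
      using that N_iff[OF v(3) MD[OF v]] orthogonal_P v L1(2) L2(2) by (blast elim: mem_C1E mem_C2E)
    then have "neighbourhood \<Gamma> (?sp v) \<inter> (C1 \<union> C2) = C1 \<union> C2" by blast
    then show ?thesis
      using C1_C2_disjoint C1_nonempty C2_nonempty by (auto simp: switched_neighbours_def Let_def)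
  qed

  \<comment> \<open>The glued maximal clique\<close>
  define K where "K = {?sp v |v. v \<noteq> 0 \<and> (v \<in> S \<and> v \<notin> L1 \<or> v \<in> L2)}"
  have K_cases: thesis
    if "x \<in> K" and "\<And>v. v \<noteq> 0 \<Longrightarrow> v \<in> S \<Longrightarrow> v \<notin> L1 \<Longrightarrow> x = ?sp v \<Longrightarrow> thesis"
      and "\<And>v. v \<noteq> 0 \<Longrightarrow> v \<in> L1 \<Longrightarrow> v \<in> L2 \<Longrightarrow> x = ?sp v \<Longrightarrow> thesis"
      and "\<And>v. v \<noteq> 0 \<Longrightarrow> v \<in> L2 \<Longrightarrow> v \<notin> L1 \<Longrightarrow> x = ?sp v \<Longrightarrow> thesis" for x thesis
    using that unfolding K_def by blast
  \<comment> \<open>Regrouped by the two sides of the switching: \<open>C2\<close> on one side, the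
    points of \<open>S\<close> outside \<open>C1\<close> on the other.\<close>
  have K_split: "x \<in> K \<longleftrightarrow> x \<in> C2 \<or> (\<exists>v. v \<noteq> 0 \<and> v \<in> S \<and> (v \<in> L1 \<longrightarrow> v \<in> L2) \<and> x = ?sp v)" for x
  proof
    assume "x \<in> K"
    then show "x \<in> C2 \<or> (\<exists>v. v \<noteq> 0 \<and> v \<in> S \<and> (v \<in> L1 \<longrightarrow> v \<in> L2) \<and> x = ?sp v)"
      by (rule K_cases) (use L1S span_mem_C2_iff in blast)+
  next
    assume "x \<in> C2 \<or> (\<exists>v. v \<noteq> 0 \<and> v \<in> S \<and> (v \<in> L1 \<longrightarrow> v \<in> L2) \<and> x = ?sp v)"
    then show "x \<in> K" unfolding K_def by (blast elim: mem_C2E)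
  qed
  have SMD: "?sp v \<in> ?D" if "v \<noteq> 0" "v \<in> S" "v \<in> L1 \<longrightarrow> v \<in> L2" for v
    using that SD MD by blast
  have sw_C2: "C2 \<subseteq> switched_neighbours \<Gamma> C1 C2 (?sp v)"
    if "v \<noteq> 0" "v \<in> S" "v \<in> L1 \<longrightarrow> v \<in> L2" for v
    using that swS[of v] swM[of v] by blast
  have sp_out: "?sp v \<notin> K" if "v \<noteq> 0" "v \<notin> S" "v \<notin> L2" for v
  proof
    assume "?sp v \<in> K"
    then obtain w where w: "?sp v = ?sp w" "w \<in> S \<or> w \<in> L2" unfolding K_def by blast
    then obtain c where "v = c *s w" using span_singleton_eqD by blast
    then show False using w(2) that S L2(1) vec.subspace_scale by blast
  qed

  have clique: "maximal_clique ?G K"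
    unfolding maximal_clique_def
  proof (intro conjI ballI impI)
    have V: "pverts ?G = pverts \<Gamma>" by (simp add: switch_def Let_def)
    show "K \<subseteq> pverts ?G" unfolding V
      using SMD C_subset_pverts K_split by blast
    show "(x, y) \<in> parcs ?G" if x: "x \<in> K" and y: "y \<in> K" and xy: "x \<noteq> y" for x y
      using x[unfolded K_split] y[unfolded K_split]
    proof (elim disjE exE conjE)
      assume "x \<in> C2" "y \<in> C2"
      then show ?thesis using parcs_switch(1)[of x C1 C2 y \<Gamma>] parcs_C_iff xy by blast
    next
      fix w assume "x \<in> C2" "w \<noteq> 0" "w \<in> S" "w \<in> L1 \<longrightarrow> w \<in> L2" "y = ?sp w"
      then show ?thesis using parcs_switch(4)[of x C1 C2 y \<Gamma>] SMD[of w] sw_C2[of w] by blast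
    next
      fix v assume "y \<in> C2" "v \<noteq> 0" "v \<in> S" "v \<in> L1 \<longrightarrow> v \<in> L2" "x = ?sp v"
      then show ?thesis using parcs_switch(3)[of x \<Gamma> C1 C2 y] SMD[of v] sw_C2[of v] by blast
    next
      fix v w assume "v \<noteq> 0" "v \<in> S" "v \<in> L1 \<longrightarrow> v \<in> L2" "x = ?sp v"
        "w \<noteq> 0" "w \<in> S" "w \<in> L1 \<longrightarrow> w \<in> L2" "y = ?sp w"
      then show ?thesis using DD[of v w] SMD[of v] SMD[of w] orth_S xy by blast
    qed
    fix x assume x: "x \<in> pverts ?G - K"
    then obtain v where v: "v \<noteq> 0" "B v v = 0" "x = ?sp v" unfolding V using pverts_iff by blast
    have e1: "e \<notin> L1" "e \<noteq> 0" using eP L1(2) f0 by auto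
    show "\<exists>y\<in>K. (x, y) \<notin> parcs ?G"
    proof (cases "x \<in> C1")
      case True
      \<comment> \<open>After switching, the neighbours of this point in
        \<open>C1 \<union> C2\<close> are \<open>C2\<close>, so it excludes every vertex of
        \<open>C1\<close>.\<close>
      have "?sp e \<in> K" using K_split e1 eS by blast
      moreover have "(x, ?sp e) \<notin> parcs ?G"
        using parcs_switch(4)[of x C1 C2 "?sp e" \<Gamma>] SD[OF eS e1(1)] swS[OF eS e1(1)] True
          C1_C2_disjoint by blast
      ultimately show ?thesis by blast
    next
      case False
      then have xD: "?sp v \<in> ?D" using x K_split v unfolding V by blast
      have vS: "v \<notin> S"
      proof
        assume "v \<in> S"
        moreover have "v \<in> L1 \<longrightarrow> v \<in> L2" using D_iff[OF v(1)] xD by blast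
        ultimately show False using x K_split v by blast
      qed
      show ?thesis
      proof (rule ccontr)
        assume "\<not> ?thesis"
        then have adj: "(?sp v, y) \<in> parcs ?G" if "y \<in> K" for y using that v by blast
        have off: "B v s = 0" if s: "s \<in> S" "s \<notin> L1" for s
        proof -
          have "?sp s \<in> K" using K_split s f0 by blast
          then show ?thesis using adj DD[OF v(1) xD, of s] SD[OF s] s f0 by blast
        qed
        \<comment> \<open>The vectors of \<open>S\<close> outside \<open>L1\<close> span
          \<open>S\<close>: a vector \<open>s\<close> of \<open>L1\<close> is
          \<open>(s + e) - e\<close>.\<close>
        have "B v s = 0" if s: "s \<in> S" for s
        proof (cases "s \<in> L1")
          case True
          have "s + e \<notin> L1" using vec.subspace_diff[OF L1(1), of "s + e" s] True e1 by auto
          then have "B v (s + e) = 0" using off s eS S vec.subspace_add by blast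
          then show ?thesis using off[OF eS e1(1)] by (simp add: form_add_right)
        qed (use off s in blast)
        then show False using S_max v(2) vS by blast
      qed
    qed
  qed

  \<comment> \<open>Traces on the glued clique\<close>
  let ?u = "?sp a"
  have uC: "?u \<in> C1" using span_mem_C1_iff a a0 by blast
  \<comment> \<open>The vertex in \<open>C1\<close> has lost the points of \<open>S - L1\<close> but
    kept all points of \<open>L2\<close>, so removing its trace leaves just the piece of
    \<open>K\<close> coming from \<open>S - L1\<close>.\<close>
  have uN: "x \<in> neighbourhood ?G ?u \<longleftrightarrow> \<not> (\<exists>s. s \<in> S \<and> s \<notin> L1 \<and> x = ?sp s)" if "x \<in> K" for x
    using that
  proof (rule K_cases)
    fix v assume v: "v \<in> S" "v \<notin> L1" "x = ?sp v"
    then have "(?u, x) \<notin> parcs ?G"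
      using parcs_switch(4)[of ?u C1 C2 x \<Gamma>] SD[of v] swS[of v] uC C1_C2_disjoint by blast
    then show ?thesis using v by (auto simp: neighbourhood_def)
  next
    fix v assume v: "v \<noteq> 0" "v \<in> L1" "v \<in> L2" "x = ?sp v"
    then have "(?u, x) \<in> parcs ?G"
      using parcs_switch(4)[of ?u C1 C2 x \<Gamma>] MD[of v] swM[of v] uC by blast
    moreover have "s \<in> L1" if "x = ?sp s" for s
      using that v span_singleton_eqD[of s v] L1(1) vec.subspace_scale by auto
    ultimately show ?thesis by (auto simp: neighbourhood_def)
  next
    fix v assume v: "v \<noteq> 0" "v \<in> L2" "v \<notin> L1" "x = ?sp v"
    then have xC: "x \<in> C2" using span_mem_C2_iff by blast
    then have "(?u, x) \<in> parcs ?G"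
      using parcs_switch(1)[of ?u C1 C2 x \<Gamma>] uC parcs_C_iff C1_C2_disjoint by blast
    moreover have "x \<notin> ?D" using xC by blast
    ultimately show ?thesis using SD by (auto simp: neighbourhood_def)
  qed
  have zD: "?sp y \<in> ?D" if "B p y \<noteq> 0" "B y y = 0" for y
    using D_iff[of y] z_out[OF that(1)] that L1(2) L2(2) by blast
  have zS: "?sp s \<in> neighbourhood ?G (?sp y) \<longleftrightarrow> B s y = 0"
    if "B p y \<noteq> 0" "B y y = 0" "s \<in> S" "s \<notin> L1" for s y
  proof -
    have "?sp y \<noteq> ?sp s"
    proof
      assume "?sp y = ?sp s"
      then obtain c where "y = c *s s" using span_singleton_eqD by blast
      then show False using z_out[OF that(1)] S that vec.subspace_scale by blast
    qed
    then show ?thesis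
      using DD[OF _ zD[OF that(1,2)] _ SD[OF that(3,4)]] z_out[OF that(1)] f0 that(4) orthogonal_sym
      by (auto simp: neighbourhood_def)
  qed
  have trace_off: "neighbourhood ?G (?sp y) \<inter> K - neighbourhood ?G ?u =
      {?sp s |s. s \<in> S \<and> s \<notin> L1 \<and> B s y = 0}" if y: "B p y \<noteq> 0" "B y y = 0" for y
  proof (intro equalityI subsetI)
    fix x assume x: "x \<in> neighbourhood ?G (?sp y) \<inter> K - neighbourhood ?G ?u"
    then obtain s where "s \<in> S" "s \<notin> L1" "x = ?sp s" using uN by blast
    then show "x \<in> {?sp s |s. s \<in> S \<and> s \<notin> L1 \<and> B s y = 0}" using x zS[OF y] by blast
  next
    fix x assume "x \<in> {?sp s |s. s \<in> S \<and> s \<notin> L1 \<and> B s y = 0}"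
    then obtain s where s: "s \<in> S" "s \<notin> L1" "x = ?sp s" "B s y = 0" by blast
    then have "x \<in> K" using K_split f0 by blast
    then show "x \<in> neighbourhood ?G (?sp y) \<inter> K - neighbourhood ?G ?u" using uN s zS[OF y] by blast
  qed
  \<comment> \<open>The witnesses \<open>h\<close> and \<open>h'\<close> show that \<open>y\<close>
    sees some but not all of \<open>C2\<close>. Its trace is then neither \<open>C1\<close> nor
    \<open>C2\<close>, and switching does not change its neighbours.\<close>
  have zC: "?sp g \<in> neighbourhood ?G (?sp y) \<longleftrightarrow> B g y = 0"
    if y: "B p y \<noteq> 0" "B y y = 0" and h: "h \<in> L2" "h \<notin> L1" "B h y = 0"
      and h': "h' \<in> L2" "h' \<notin> L1" "B h' y \<noteq> 0" and g: "g \<in> L2" "g \<notin> L1" for y h h' g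
  proof -
    let ?N = "neighbourhood \<Gamma> (?sp y) \<inter> (C1 \<union> C2)"
    have y0: "y \<noteq> 0" using z_out y by blast
    have N: "?sp x \<in> ?N \<longleftrightarrow> B x y = 0" and C2: "?sp x \<in> C2" if "x \<in> L2" "x \<notin> L1" for x
      using N_iff[OF y0 zD[OF y], of x] f0[OF that(2)] span_mem_C2_iff that orthogonal_sym by blast+
    have "?N \<noteq> C1" using N[OF h(1,2)] C2[OF h(1,2)] h(3) C1_C2_disjoint by blast
    moreover have "?N \<noteq> C2" using N[OF h'(1,2)] C2[OF h'(1,2)] h'(3) by blast
    ultimately have "switched_neighbours \<Gamma> C1 C2 (?sp y) = ?N"
      by (simp add: switched_neighbours_def Let_def)
    then show ?thesis
      using parcs_switch(3)[OF zD[OF y], of "?sp g"] C2[OF g] N[OF g] by (simp add: neighbourhood_def)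
  qed
  \<comment> \<open>\<open>f\<close> and \<open>f + p\<close> differ by \<open>p\<close>, which is
    orthogonal to neither \<open>z\<close> nor \<open>z'\<close>, so each of the two is orthogonal
    to exactly one of \<open>f\<close> and \<open>f + p\<close>.\<close>
  have fz: "B (f + p) z \<noteq> 0" "B f z' \<noteq> 0" using z z' by (auto simp: form_add_left)
  have z_in: "?sp z \<in> pverts ?G - K" "?sp z' \<in> pverts ?G - K" "?u \<in> pverts ?G - K"
  proof -
    have V: "pverts ?G = pverts \<Gamma>" by (simp add: switch_def Let_def)
    show "?sp z \<in> pverts ?G - K" "?sp z' \<in> pverts ?G - K"
      using zD z(1,5) z'(1,5) z_out sp_out L2(2) unfolding V by blast+
    have "?u \<notin> K"
    proof
      assume "?u \<in> K"
      then obtain v where v: "v \<noteq> 0" "v \<in> S" "v \<in> L1 \<longrightarrow> v \<in> L2" "?u = ?sp v"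
        using K_split uC C1_C2_disjoint by blast
      then show False using SMD[of v] uC by auto
    qed
    then show "?u \<in> pverts ?G - K" using uC C_subset_pverts unfolding V by blast
  qed
  have S_same: "B s z = 0 \<longleftrightarrow> B s z' = 0" if "s \<in> S" for s
    using S_p[OF that, of z] S_p[OF that, of z'] z z' by blast
  have "neighbourhood ?G (?sp z) \<inter> K - neighbourhood ?G ?u = neighbourhood ?G (?sp z') \<inter> K - neighbourhood ?G ?u"
    unfolding trace_off[OF z(5,1)] trace_off[OF z'(5,1)] using S_same by blast
  \<comment> \<open>The point spanned by \<open>e\<close> is a witness.\<close>
  moreover have "neighbourhood ?G (?sp z) \<inter> K - neighbourhood ?G ?u \<noteq> {}"
    using trace_off[OF z(5,1)] eS eP L1(2) z(3) by blast
  ultimately have "neighbourhood ?G (?sp z) \<inter> K = neighbourhood ?G (?sp z') \<inter> K"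
    using G clique z_in unfolding traces_determined_off_trace_def by blast
  moreover have "?sp f \<in> neighbourhood ?G (?sp z) \<inter> K"
    using zC[OF z(5,1) f z(4) fp fz(1) f] z(4) f f0 K_split span_mem_C2_iff by blast
  moreover have "?sp f \<notin> neighbourhood ?G (?sp z')"
    using zC[OF z'(5,1) fp z'(4) f fz(2) f] fz(2) by blast
  ultimately show False by blast
qed

end

theorem theorem6:
  fixes perp :: "('a::{field,finite} ^ 'n) set \<Rightarrow> ('a ^ 'n) set"
    and P L1 L2 :: "('a ^ 'n) set"
    and d m :: nat
  assumes "classical_polarity perp"
    and "has_rank perp d" and "d \<ge> 3"
    and "totally_isotropic perp P" and "vec.dim P = m" and "2 \<le> m" and "m \<le> d"
    and "vec.subspace L1" and "L1 \<subseteq> P" and "vec.dim L1 = m - 1"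
    and "vec.subspace L2" and "L2 \<subseteq> P" and "vec.dim L2 = m - 1"
    and "L1 \<noteq> L2"
  defines "\<Gamma> \<equiv> collinearity_graph perp"
    and "C1 \<equiv> {x \<in> points L1. \<not> x \<subseteq> L2}"
    and "C2 \<equiv> {x \<in> points L2. \<not> x \<subseteq> L1}"
  shows "switching_set \<Gamma> C1 C2 \<and>
         (d = m \<and> m \<ge> 3 \<longrightarrow> \<not> digraph_iso (with_proj \<Gamma>) (with_proj (switch \<Gamma> C1 C2)))"
proof -
  obtain B \<sigma> where "polar_form perp B \<sigma>" using classical_polarity_polar_form assms(1) by blast
  then interpret polar_form perp B \<sigma> .
  \<comment> \<open>Since \<open>2 \<le> m\<close>, the subtraction in \<open>m - 1\<close> is
    genuine and yields the additive dimension conditions.\<close>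
  interpret hp: hyperplane_pair perp B \<sigma> P L1 L2
    using assms by unfold_locales auto
  have C: "C1 = hp.C1" "C2 = hp.C2" by (simp_all add: C1_def C2_def hp.C1_def hp.C2_def)
  show ?thesis
    unfolding C \<Gamma>_def
    using hp.switching_set hp.not_traces_determined_off_trace_switch assms(2,5)
      traces_determined_off_trace_collinearity_graph traces_determined_off_trace_iso
    by blast
qed

end
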